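(* Let $2\le m\le d$ be integers. For $w\in C_m$ and $l=(l_0,l_1,\dots,l_{m-1})\in\mathbb{R}_+^m$ put $$G(w,l)=\sum_{k=0}^{m-1} l_k^{\,m-k}\,\frac{P_k(w)}{P_m(w)}.$$ Then for any $(w,l),(\tilde w,\tilde l)\in C_m\times\mathbb{R}_+^m$, $$G\Big(\frac{w+\tilde w}{2},\frac{l+\tilde l}{2}\Big)\le\max\big(G(w,l),\,G(\tilde w,\tilde l)\big),$$ that is, $G$ is quasiconvex in $C_m\times\mathbb{R}_+^m$.
   Context: $\mathbb{R}_+$ denotes the set of all nonnegative real numbers, and $\mathbb{S}^d$ the set of symmetric $d\times d$ real matrices. $P_k(w)$ is the $k$th elementary symmetric polynomial of the eigenvalues of $w\in\mathbb{S}^d$ ($P_0=1$). $C_m$ is the open connected component of $\{w\in\mathbb{S}^d:P_m(w)>0\}$ containing the identity matrix. *)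

theory Defs
  imports "HOL-Analysis.Analysis" "HOL-Computational_Algebra.Polynomial"
begin

text \<open>
  Real symmetric \<open>d\<times>d\<close> matrices are the symmetric elements of \<^typ>\<open>real^'d^'d\<close>, with
  \<open>d = CARD('d)\<close>.
\<close>

definition charpoly :: "'a::comm_ring_1^'n^'n \<Rightarrow> 'a poly" where
  "charpoly A = det (mat [:0, 1:] - map_matrix (\<lambda>a. [:a:]) A)"

text \<open>
  The real eigenvalues, repeated according to algebraic multiplicity, in increasing order. For a
  symmetric matrix these are all the eigenvalues, so the list has length \<open>CARD('n)\<close>.
\<close>

definition eigenvalues :: "real^'n^'n \<Rightarrow> real list" where
  "eigenvalues A = sorted_list_of_multiset (proots (charpoly A))"

definition elem_sym :: "nat \<Rightarrow> 'a::comm_ring_1 list \<Rightarrow> 'a" where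
  "elem_sym k xs = (\<Sum>I | I \<subseteq> {..<length xs} \<and> card I = k. \<Prod>i\<in>I. xs ! i)"

definition P_sym :: "nat \<Rightarrow> real^'d^'d \<Rightarrow> real" where
  "P_sym k w = elem_sym k (eigenvalues w)"

definition C_cone :: "nat \<Rightarrow> (real^'d^'d) set" where
  "C_cone m = connected_component_set {w. transpose w = w \<and> P_sym m w > 0} (mat 1)"

text \<open>
  A tuple \<open>(l\<^sub>0, \<dots>, l\<^sub>m\<^sub>-\<^sub>1)\<close> is a function on \<^typ>\<open>nat\<close> of which only the values below \<open>m\<close> matter.
\<close>

definition G_fun :: "nat \<Rightarrow> real^'d^'d \<Rightarrow> (nat \<Rightarrow> real) \<Rightarrow> real" where
  "G_fun m w l = (\<Sum>k<m. l k ^ (m - k) * (P_sym k w / P_sym m w))"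

end

theory Submission
  imports Defs "HOL-Computational_Algebra.Fundamental_Theorem_Algebra"
begin

text \<open>
  Write \<open>q\<^sub>j = P\<^sub>j\<^sub>+\<^sub>1 / P\<^sub>j\<close>. Since \<open>P\<^sub>m = q\<^sub>m\<^sub>-\<^sub>1 P\<^sub>m\<^sub>-\<^sub>1\<close> and
  \<open>P\<^sub>m\<^sub>-\<^sub>1 / P\<^sub>k\<close> is the product of the \<open>q\<^sub>j\<close> with \<open>k \<le> j < m - 1\<close>, the inequality \<open>G \<le> a\<close> is the same
  as
  \<open>(\<Sum>k<m. l\<^sub>k\<^sup>m\<^sup>-\<^sup>k / (\<Prod>j=k..<m-1. q\<^sub>j)) \<le> a q\<^sub>m\<^sub>-\<^sub>1\<close>.
  If every \<open>q\<^sub>j\<close> is concave and positive, then for \<open>a \<ge> 0\<close> the right-hand side is concave, while the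
  left-hand side is convex: the function \<open>x\<^sup>p\<^sup>+\<^sup>1 / (y\<^sub>1 \<dots> y\<^sub>p)\<close> with \<open>x \<ge> 0\<close> and
  \<open>y\<^sub>i > 0\<close> is jointly convex and nonincreasing in each \<open>y\<^sub>i\<close>. So the sublevel sets of \<open>G\<close> are convex. Dividing by \<open>P\<^sub>m\<^sub>-\<^sub>1\<close> rather than by \<open>P\<^sub>m\<close> is what makes
  the degrees right: the single quotients \<open>l\<^sub>k\<^sup>m\<^sup>-\<^sup>k P\<^sub>k / P\<^sub>m\<close> are quasiconvex, which would say nothing
  about their sum.

  The concavity of \<open>q\<^sub>j\<close> is shown first for vectors, as a function of the eigenvalues
  (\<open>esym_ratio_support\<close>). With \<open>r\<^sub>i\<close> the ratio of one degree less in the variables other than \<open>x\<^sub>i\<close>,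
  \<open>(j + 1) q\<^sub>j = (\<Sum>i. x\<^sub>i r\<^sub>i / (x\<^sub>i + r\<^sub>i))\<close>, and the parallel sum is concave and increasing in \<open>r\<^sub>i\<close>, so
  induction on \<open>j\<close> applies. It needs that removing a variable from a vector with positive \<open>e\<^sub>0, \<dots>, e\<^sub>j\<close>
  leaves \<open>e\<^sub>0, \<dots>, e\<^sub>j\<^sub>-\<^sub>1\<close> positive, which follows from Newton's inequality. The induction does not use
  derivatives; it produces directly a linear functional that lies above \<open>q\<^sub>j\<close> and touches it at a given
  point.

  The passage to matrices follows Davis. Let \<open>M\<close> be diagonal in an orthonormal basis \<open>v\<close>, let \<open>g\<close> be the
  functional that touches \<open>q\<^sub>j\<close> at the eigenvalues of \<open>M\<close>, and let \<open>L A = (\<Sum>i. g\<^sub>i \<langle>v\<^sub>i, A v\<^sub>i\<rangle>)\<close>. The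
  vector of the \<open>\<langle>v\<^sub>i, A v\<^sub>i\<rangle>\<close> is the image of the eigenvalues of \<open>A\<close> under a doubly stochastic matrix, and
  a linear functional of doubly stochastic matrices is at least its value at some permutation
  (\<open>doubly_stochastic_ge_permutation\<close>). Hence \<open>q\<^sub>j(A) \<le> L A\<close>, with equality at \<open>M\<close>
  (\<open>P_ratio_support\<close>), and \<open>q\<^sub>j\<close> is concave on the convex set of symmetric matrices with
  \<open>P\<^sub>1, \<dots>, P\<^sub>j > 0\<close>.

  Concavity of the \<open>q\<^sub>j\<close> also shows step by step that the set of symmetric matrices with
  \<open>P\<^sub>1, \<dots>, P\<^sub>m > 0\<close> is convex. It is open in \<open>{P\<^sub>m > 0}\<close> by continuity and closed there because of
  \<open>P\<^sub>k\<^sub>+\<^sub>1 \<le> P\<^sub>1 P\<^sub>k\<close>, so it is the component of the identity (\<open>C_cone_eq_garding_cone\<close>).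
\<close>

section \<open>Newton's inequality for split real polynomials\<close>

text \<open>
  Products of constants and linear factors \<open>[:a, b:]\<close>. Degenerate factors are admitted, so that the zero
  polynomial belongs to the class and the class is closed under derivatives without exception.
\<close>

inductive splits :: "real poly \<Rightarrow> bool" where
  const: "splits [:c:]"
| factor: "splits p \<Longrightarrow> splits ([:a, b:] * p)"

lemma splits_prod_linear:
  assumes "finite I"
  shows "splits (\<Prod>i\<in>I. [:a i, b i:])"
  using assms
proof (induction I)
  case empty
  show ?case using splits.const[of 1] by (simp add: pCons_one)
next
  case (insert i I)
  then show ?case by (simp add: splits.factor del: mult_pCons_left)
qed

lemma map_poly_of_real_mult:
  "map_poly complex_of_real (p * q) = map_poly of_real p * map_poly of_real q"
  by (intro poly_eqI) (simp add: coeff_map_poly coeff_mult)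

lemma poly_map_of_real_linear: "poly (map_poly complex_of_real [:a, b:]) z = of_real a + z * of_real b"
  by (simp add: map_poly_pCons)

lemma pderiv_map_of_real: "pderiv (map_poly complex_of_real p) = map_poly of_real (pderiv p)"
  by (intro poly_eqI) (simp add: coeff_pderiv coeff_map_poly)

text \<open>
  The logarithmic derivative is a sum of terms \<open>b / (a + b z)\<close>, each of which maps the upper half-plane
  to the closed lower one, strictly if \<open>b \<noteq> 0\<close>. Hence the derivative has no zero in the upper half-plane
  unless it vanishes identically (the Gauss-Lucas theorem for a half-plane).
\<close>

lemma splits_upper_half_plane:
  assumes "splits p" "p \<noteq> 0" "Im z > 0"
  defines "P \<equiv> map_poly complex_of_real p"
  shows "poly P z \<noteq> 0 \<and>
    (pderiv p = 0 \<or> Im (poly (pderiv P) z / poly P z) < 0)"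
  using assms(1,2) unfolding P_def
proof (induction p)
  case (const c)
  then show ?case by (simp add: map_poly_pCons pderiv_pCons)
next
  case (factor q a b)
  define Q where "Q = map_poly complex_of_real q"
  define L where "L = map_poly complex_of_real [:a, b:]"
  have q0: "q \<noteq> 0" and ab: "a \<noteq> 0 \<or> b \<noteq> 0" using factor.prems by auto
  have PQ: "map_poly complex_of_real ([:a, b:] * q) = L * Q"
    unfolding Q_def L_def by (rule map_poly_of_real_mult)
  have Lz: "poly L z = of_real a + z * of_real b"
    unfolding L_def by (rule poly_map_of_real_linear)
  have dL: "pderiv L = [:of_real b:]"
    unfolding L_def by (simp add: map_poly_pCons pderiv_pCons)
  have Lnz: "poly L z \<noteq> 0"
    using ab assms(3) by (auto simp: Lz complex_eq_iff)
  have Qnz: "poly Q z \<noteq> 0" and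
    IH: "pderiv q = 0 \<or> Im (poly (pderiv Q) z / poly Q z) < 0"
    using factor.IH[OF q0] by (auto simp: Q_def)
  have ratio: "poly (pderiv (L * Q)) z / poly (L * Q) z
      = of_real b / poly L z + poly (pderiv Q) z / poly Q z"
    using Lnz Qnz by (simp add: pderiv_mult dL field_simps)
  have ImL: "Im (of_real b / poly L z) = - (b\<^sup>2 * Im z) / (cmod (poly L z))\<^sup>2"
    unfolding Lz cmod_power2 by (simp add: Im_divide power2_eq_square)
  show ?case
  proof (cases "b = 0")
    case True
    then show ?thesis
      unfolding PQ using IH Lnz Qnz ratio True
      by (auto simp: pderiv_mult pderiv_pCons pderiv_smult)
  next
    case False
    have "Im (poly (pderiv Q) z / poly Q z) \<le> 0"
      using IH by (auto simp: Q_def pderiv_map_of_real)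
    moreover have "Im (of_real b / poly L z) < 0"
      unfolding ImL using False assms(3) Lnz by (simp add: divide_neg_pos)
    ultimately show ?thesis
      unfolding PQ ratio using Lnz Qnz by simp
  qed
qed

lemma cnj_root_of_real_poly:
  assumes "poly (map_poly complex_of_real p) z = 0"
  shows "poly (map_poly complex_of_real p) (cnj z) = 0"
proof -
  have "map_poly cnj (map_poly complex_of_real p) = map_poly of_real p"
    by (intro poly_eqI) (simp add: coeff_map_poly)
  then show ?thesis using poly_cnj[of "map_poly complex_of_real p" z] assms by simp
qed

text \<open>
  Nonreal roots of a real polynomial come in conjugate pairs, so all roots are real and can be split off
  one at a time.
\<close>

lemma splits_if_no_upper_root:
  assumes "p \<noteq> 0" "\<And>z. Im z > 0 \<Longrightarrow> poly (map_poly complex_of_real p) z \<noteq> 0"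
  shows "splits p"
  using assms
proof (induction "degree p" arbitrary: p)
  case 0
  then obtain c where "p = [:c:]" by (metis degree_eq_zeroE)
  then show ?case by (simp add: splits.const)
next
  case (Suc n)
  let ?P = "map_poly complex_of_real p"
  have dP: "degree ?P = Suc n" using Suc.hyps(2) by (simp add: degree_map_poly)
  have "\<not> constant (poly ?P)"
    using dP by (simp add: constant_degree)
  then obtain z where z: "poly ?P z = 0"
    using fundamental_theorem_of_algebra by blast
  have "Im z = 0"
    using Suc.prems(2)[of z] Suc.prems(2)[of "cnj z"] z cnj_root_of_real_poly[OF z]
    by (cases "Im z" "0::real" rule: linorder_cases) auto
  then have zr: "z = of_real (Re z)" by (simp add: complex_eq_iff)
  have "poly ?P (of_real (Re z)) = of_real (poly p (Re z))"
    by (simp add: poly_altdef degree_map_poly coeff_map_poly)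
  then have "poly p (Re z) = 0" using z zr by simp
  then obtain q where q: "p = [:- Re z, 1:] * q" by (metis poly_eq_0_iff_dvd dvdE)
  have q0: "q \<noteq> 0" using Suc.prems(1) q by auto
  have "degree p = degree [:- Re z, 1:] + degree q"
    unfolding q using q0 by (intro degree_mult_eq) auto
  then have "n = degree q" using Suc.hyps(2) by simp
  moreover have "poly (map_poly complex_of_real q) w \<noteq> 0" if "Im w > 0" for w
    using Suc.prems(2)[OF that] unfolding q map_poly_of_real_mult by auto
  ultimately have "splits q" using Suc.hyps(1) q0 by blast
  then show ?case unfolding q by (rule splits.factor)
qed

lemma splits_pderiv:
  assumes "splits p"
  shows "splits (pderiv p)"
proof (cases "pderiv p = 0")
  case True
  then show ?thesis using splits.const[of 0] by simp
next
  case False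
  then have p0: "p \<noteq> 0" by auto
  show ?thesis
  proof (rule splits_if_no_upper_root[OF False])
    fix z :: complex assume "Im z > 0"
    from splits_upper_half_plane[OF assms p0 this] False
    show "poly (map_poly complex_of_real (pderiv p)) z \<noteq> 0"
      by (auto simp: pderiv_map_of_real)
  qed
qed

text \<open>
  The difference of the two sides is \<open>p'(0)\<^sup>2 - p(0) p''(0)\<close>, which multiplication by a linear factor keeps
  nonnegative.
\<close>

lemma splits_low_newton:
  assumes "splits p"
  shows "2 * coeff p 0 * coeff p 2 \<le> (coeff p 1)\<^sup>2"
  using assms
proof (induction p)
  case (const c)
  then show ?case by (simp add: numeral_2_eq_2)
next
  case (factor q a b)
  have "(coeff ([:a, b:] * q) 1)\<^sup>2 - 2 * coeff ([:a, b:] * q) 0 * coeff ([:a, b:] * q) 2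
      = a\<^sup>2 * ((coeff q 1)\<^sup>2 - 2 * coeff q 0 * coeff q 2) + b\<^sup>2 * (coeff q 0)\<^sup>2"
    by (simp add: numeral_2_eq_2 coeff_pCons algebra_simps power2_eq_square)
  moreover have "0 \<le> a\<^sup>2 * ((coeff q 1)\<^sup>2 - 2 * coeff q 0 * coeff q 2)"
    using factor.IH by simp
  ultimately show ?case by (smt (verit) mult_nonneg_nonneg zero_le_power2)
qed

text \<open>
  The preceding inequality for the \<open>k\<close>-th derivative, which splits as well. The constant
  \<open>(k + 2) / (k + 1)\<close> that it yields is then dropped.
\<close>

lemma splits_newton:
  assumes "splits p"
  shows "coeff p k * coeff p (Suc (Suc k)) \<le> (coeff p (Suc k))\<^sup>2"
proof -
  define c where "c j = coeff p (k + j)" for j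
  have s: "splits ((pderiv ^^ k) p)" 
    using assms by (induction k) (auto intro: splits_pderiv)
  have cf: "fact j * coeff ((pderiv ^^ k) p) j = fact (k + j) * c j" for j
    unfolding c_def
  proof (induction k arbitrary: j)
    case (Suc k)
    have "fact j * coeff ((pderiv ^^ Suc k) p) j = fact (Suc j) * coeff ((pderiv ^^ k) p) (Suc j)"
      by (simp add: coeff_pderiv)
    also have "\<dots> = fact (k + Suc j) * coeff p (k + Suc j)" by (rule Suc)
    finally show ?case by simp
  qed simp
  have c0: "coeff ((pderiv ^^ k) p) 0 = fact k * c 0" using cf[of 0] by simp
  have c1: "coeff ((pderiv ^^ k) p) 1 = fact k * (real k + 1) * c 1" using cf[of 1] by (simp add: algebra_simps)
  have c2: "2 * coeff ((pderiv ^^ k) p) 2 = fact k * (real k + 1) * (real k + 2) * c 2"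
    using cf[of 2] by (simp add: algebra_simps numeral_2_eq_2)
  have "fact k * c 0 * (fact k * (real k + 1) * (real k + 2) * c 2) \<le> (fact k * (real k + 1) * c 1)\<^sup>2"
    using splits_low_newton[OF s] unfolding c0 c1 c2[symmetric] by simp
  then have "(fact k)\<^sup>2 * (real k + 1) * ((real k + 2) * (c 0 * c 2)) \<le> (fact k)\<^sup>2 * (real k + 1) * ((real k + 1) * (c 1)\<^sup>2)"
    by (simp add: power2_eq_square algebra_simps)
  then have *: "(real k + 2) * (c 0 * c 2) \<le> (real k + 1) * (c 1)\<^sup>2"
    by (subst (asm) mult_le_cancel_left_pos) auto
  have "c 0 * c 2 \<le> (c 1)\<^sup>2"
  proof (cases "c 0 * c 2 \<le> 0")
    case True
    then show ?thesis by (smt (verit) zero_le_power2)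
  next
    case False
    have "(real k + 1) * (c 0 * c 2) \<le> (real k + 2) * (c 0 * c 2)"
      using False by (intro mult_right_mono) auto
    with * have "(real k + 1) * (c 0 * c 2) \<le> (real k + 1) * (c 1)\<^sup>2" by linarith
    then show ?thesis by (subst (asm) mult_le_cancel_left_pos) auto
  qed
  then show ?thesis by (simp add: c_def numeral_2_eq_2)
qed

section \<open>Elementary symmetric functions and their ratios\<close>

text \<open>
  Defining the elementary symmetric functions as coefficients of \<open>\<Prod>i. 1 + x\<^sub>i X\<close> makes the recursion, the
  Euler-type identity (through the derivative) and Newton's inequality immediate. The variables are
  indexed by a set, so that one of them can be removed.
\<close>

definition esym :: "nat \<Rightarrow> 'i set \<Rightarrow> ('i \<Rightarrow> real) \<Rightarrow> real" where
  "esym k I x = coeff (\<Prod>i\<in>I. [:1, x i:]) k"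

lemma esym_0 [simp]: "esym 0 I x = 1"
proof -
  have "esym 0 I x = poly (\<Prod>i\<in>I. [:1, x i:]) 0"
    by (simp add: esym_def poly_0_coeff_0)
  also have "\<dots> = 1" by (simp add: poly_prod)
  finally show ?thesis .
qed

lemma esym_remove:
  assumes "finite I" "i \<in> I"
  shows "esym (Suc k) I x = x i * esym k (I - {i}) x + esym (Suc k) (I - {i}) x"
  unfolding esym_def prod.remove[OF assms] by simp

lemma Suc_esym_Suc:
  assumes "finite I"
  shows "real (Suc k) * esym (Suc k) I x = (\<Sum>i\<in>I. x i * esym k (I - {i}) x)"
proof -
  have "real (Suc k) * esym (Suc k) I x = coeff (pderiv (\<Prod>i\<in>I. [:1, x i:])) k"
    unfolding esym_def coeff_pderiv by simp
  also have "pderiv (\<Prod>i\<in>I. [:1, x i:]) = (\<Sum>i\<in>I. smult (x i) (\<Prod>j\<in>I - {i}. [:1, x j:]))"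
    unfolding pderiv_prod by (intro sum.cong) (auto simp: pderiv_pCons)
  finally show ?thesis by (simp add: coeff_sum esym_def)
qed

lemma esym_newton:
  assumes "finite I"
  shows "esym k I x * esym (Suc (Suc k)) I x \<le> (esym (Suc k) I x)\<^sup>2"
  unfolding esym_def by (intro splits_newton splits_prod_linear assms)

lemma esym_reindex:
  assumes "bij_betw s I J"
  shows "esym k I (\<lambda>i. x (s i)) = esym k J x"
  unfolding esym_def using prod.reindex_bij_betw[OF assms, of "\<lambda>j. [:1, x j:]"] by simp

text \<open>
  Garding's cone: for \<open>m \<le> card I\<close> this is the component of \<open>{e\<^sub>m > 0}\<close> that contains \<open>(1, \<dots>, 1)\<close>.
\<close>

definition garding :: "nat \<Rightarrow> 'i set \<Rightarrow> ('i \<Rightarrow> real) set" where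
  "garding m I = {x. \<forall>k\<le>m. 0 < esym k I x}"

lemma gardingD: "x \<in> garding m I \<Longrightarrow> k \<le> m \<Longrightarrow> 0 < esym k I x"
  by (simp add: garding_def)

text \<open>
  If \<open>e\<^sub>k\<^sub>+\<^sub>1\<close> of the remaining variables were the first to be nonpositive, then positivity of the two
  corresponding functions of all variables would force \<open>e\<^sub>k e\<^sub>k\<^sub>+\<^sub>2 > e\<^sub>k\<^sub>+\<^sub>1\<^sup>2\<close> for the remaining ones, against
  Newton.
\<close>

lemma garding_remove:
  assumes "finite I" "i \<in> I" "x \<in> garding (Suc m) I"
  shows "x \<in> garding m (I - {i})"
proof -
  have "0 < esym k (I - {i}) x" if "k \<le> m" for k
    using that
  proof (induction k)
    case 0
    then show ?case by simp
  next
    case (Suc k)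
    let ?e = "\<lambda>j. esym j (I - {i}) x"
    have a: "0 < ?e k" using Suc by simp
    have b: "0 < x i * ?e k + ?e (Suc k)"
      using gardingD[OF assms(3), of "Suc k"] Suc.prems esym_remove[OF assms(1,2)] by simp
    have c: "0 < x i * ?e (Suc k) + ?e (Suc (Suc k))"
      using gardingD[OF assms(3), of "Suc (Suc k)"] Suc.prems esym_remove[OF assms(1,2)] by simp
    have n: "?e k * ?e (Suc (Suc k)) \<le> (?e (Suc k))\<^sup>2"
      using assms(1) by (intro esym_newton) auto
    show ?case
    proof (rule ccontr)
      assume "\<not> 0 < ?e (Suc k)"
      then have neg: "?e (Suc k) \<le> 0" by simp
      have "0 < ?e k * (x i * ?e (Suc k) + ?e (Suc (Suc k)))"
        using a c by simp
      also have "\<dots> \<le> ?e (Suc k) * (x i * ?e k + ?e (Suc k))"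
        using n by (simp add: algebra_simps power2_eq_square)
      also have "\<dots> \<le> 0" using neg b by (simp add: mult_nonpos_nonneg)
      finally show False by simp
    qed
  qed
  then show ?thesis by (simp add: garding_def)
qed

text \<open>
  Expanding the Euler-type identity once more gives
  \<open>(k + 1) e\<^sub>k\<^sub>+\<^sub>1 = e\<^sub>1 e\<^sub>k - (\<Sum>i. x\<^sub>i\<^sup>2 e\<^sub>k\<^sub>-\<^sub>1(x without x\<^sub>i))\<close>, and the subtracted terms are nonnegative. This
  non-strict inequality is what survives a limit, and so controls the boundary of the cone.
\<close>

lemma esym_Suc_le:
  assumes "finite I" "x \<in> garding k I"
  shows "esym (Suc k) I x \<le> esym 1 I x * esym k I x"
proof (cases k)
  case 0
  then show ?thesis by simp
next
  case (Suc j)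
  have e1: "esym 1 I x = (\<Sum>i\<in>I. x i)" using Suc_esym_Suc[OF assms(1), of 0] by simp
  have "real (Suc k) * esym (Suc k) I x
      = (\<Sum>i\<in>I. x i * esym k I x - (x i)\<^sup>2 * esym j (I - {i}) x)"
    unfolding Suc_esym_Suc[OF assms(1)] Suc
    by (intro sum.cong refl) (simp add: esym_remove[OF assms(1)] algebra_simps power2_eq_square)
  also have "\<dots> \<le> (\<Sum>i\<in>I. x i * esym k I x)"
  proof (intro sum_mono)
    fix i assume i: "i \<in> I"
    have "0 < esym j (I - {i}) x"
      using garding_remove[OF assms(1) i, of x j] assms(2) Suc by (auto intro: gardingD)
    then show "x i * esym k I x - (x i)\<^sup>2 * esym j (I - {i}) x \<le> x i * esym k I x" by simp
  qed
  also have "\<dots> = esym 1 I x * esym k I x" unfolding e1 by (rule sum_distrib_right[symmetric])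
  finally have *: "real (Suc k) * esym (Suc k) I x \<le> esym 1 I x * esym k I x" .
  have pos: "0 \<le> esym 1 I x * esym k I x"
    using gardingD[OF assms(2)] Suc by (simp add: less_imp_le)
  show ?thesis
  proof (cases "esym (Suc k) I x \<le> 0")
    case False
    then have "1 * esym (Suc k) I x \<le> real (Suc k) * esym (Suc k) I x" by (intro mult_right_mono) auto
    then show ?thesis using * by simp
  qed (use pos in linarith)
qed

definition esym_ratio :: "nat \<Rightarrow> 'i set \<Rightarrow> ('i \<Rightarrow> real) \<Rightarrow> real" where
  "esym_ratio m I x = esym (Suc m) I x / esym m I x"

text \<open>
  The recursion \<open>e\<^sub>m\<^sub>+\<^sub>1 = x\<^sub>i e\<^sub>m(x without x\<^sub>i) + e\<^sub>m\<^sub>+\<^sub>1(x without x\<^sub>i)\<close> says that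
  \<open>x\<^sub>i + r\<^sub>i = e\<^sub>m\<^sub>+\<^sub>1 / e\<^sub>m(x without x\<^sub>i)\<close>; with it the Euler-type identity becomes a sum of parallel sums.
\<close>

lemma esym_ratio_Suc:
  assumes "finite I" "x \<in> garding (Suc m) I"
  defines "r \<equiv> \<lambda>i. esym_ratio m (I - {i}) x"
  shows "\<And>i. i \<in> I \<Longrightarrow> 0 < x i + r i"
    and "real (Suc (Suc m)) * esym_ratio (Suc m) I x = (\<Sum>i\<in>I. x i * r i / (x i + r i))"
proof -
  have eq: "x i + r i = esym (Suc m) I x / esym m (I - {i}) x" and
    pos: "0 < esym m (I - {i}) x" if i: "i \<in> I" for i
  proof -
    show "0 < esym m (I - {i}) x"
      using garding_remove[OF assms(1) i assms(2)] by (auto intro: gardingD)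
    then show "x i + r i = esym (Suc m) I x / esym m (I - {i}) x"
      by (simp add: r_def esym_ratio_def esym_remove[OF assms(1) i] field_simps)
  qed
  have e: "0 < esym (Suc m) I x" using assms(2) by (auto intro: gardingD)
  show "0 < x i + r i" if "i \<in> I" for i
    unfolding eq[OF that] using pos[OF that] e by simp
  have "real (Suc (Suc m)) * esym_ratio (Suc m) I x
      = (\<Sum>i\<in>I. x i * esym (Suc m) (I - {i}) x) / esym (Suc m) I x"
    unfolding esym_ratio_def Suc_esym_Suc[OF assms(1), symmetric] by simp
  also have "\<dots> = (\<Sum>i\<in>I. x i * r i / (x i + r i))"
    unfolding sum_divide_distrib
  proof (intro sum.cong refl)
    fix i assume i: "i \<in> I"
    show "x i * esym (Suc m) (I - {i}) x / esym (Suc m) I x = x i * r i / (x i + r i)"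
      unfolding eq[OF i] using pos[OF i] e by (simp add: r_def esym_ratio_def)
  qed
  finally show "real (Suc (Suc m)) * esym_ratio (Suc m) I x = (\<Sum>i\<in>I. x i * r i / (x i + r i))" .
qed

text \<open>
  The parallel sum is the infimum over \<open>\<theta>\<close> of these linear forms, like the least energy of a unit
  current split between two resistors. The difference of the two sides is
  \<open>(x - \<theta> (x + q))\<^sup>2 / (x + q)\<close>, so the infimum is attained at \<open>\<theta> = x / (x + q)\<close>.
\<close>

lemma parallel_sum_le:
  fixes x q \<theta> :: real
  assumes "0 < x + q"
  shows "x * q / (x + q) \<le> (1 - \<theta>)\<^sup>2 * x + \<theta>\<^sup>2 * q"
proof -
  have "((1 - \<theta>)\<^sup>2 * x + \<theta>\<^sup>2 * q) * (x + q) - x * q = (x - \<theta> * (x + q))\<^sup>2"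
    by (simp add: algebra_simps power2_eq_square)
  then have "x * q \<le> ((1 - \<theta>)\<^sup>2 * x + \<theta>\<^sup>2 * q) * (x + q)"
    by (smt (verit) zero_le_power2)
  then show ?thesis using assms by (simp add: divide_le_eq)
qed

lemma parallel_sum_eq:
  fixes c q :: real
  assumes "0 < c + q"
  defines "\<theta> \<equiv> c / (c + q)"
  shows "c * q / (c + q) = (1 - \<theta>)\<^sup>2 * c + \<theta>\<^sup>2 * q"
proof -
  have t: "1 - \<theta> = q / (c + q)" using assms(1) by (simp add: \<theta>_def field_simps)
  have "(1 - \<theta>)\<^sup>2 * c + \<theta>\<^sup>2 * q = (q\<^sup>2 * c + c\<^sup>2 * q) / (c + q)\<^sup>2"
    unfolding t unfolding \<theta>_def by (simp add: power_divide add_divide_distrib)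
  also have "\<dots> = c * q * (c + q) / ((c + q) * (c + q))"
    by (simp add: power2_eq_square algebra_simps)
  also have "\<dots> = c * q / (c + q)" using assms(1) by simp
  finally show ?thesis by simp
qed

text \<open>
  Concavity in the form that passes to matrices: at each point of the cone a homogeneous linear
  functional touches the ratio from above. By induction, \<open>r\<^sub>i\<close> has such a functional \<open>h\<^sub>i\<close>; inserting it
  into the linear upper bound of the parallel sum, with the \<open>\<theta>\<close> that is optimal at the point of contact,
  gives the functional for the next degree.
\<close>

lemma esym_ratio_support:
  assumes "finite I" "y \<in> garding m I"
  obtains g where "esym_ratio m I y = (\<Sum>i\<in>I. g i * y i)"
    and "\<And>x. x \<in> garding m I \<Longrightarrow> esym_ratio m I x \<le> (\<Sum>i\<in>I. g i * x i)"
  using assms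
proof (induction m arbitrary: I thesis)
  case 0
  have "esym_ratio 0 I x = (\<Sum>i\<in>I. 1 * x i)" for x
    using Suc_esym_Suc[OF \<open>finite I\<close>, of 0 x] by (simp add: esym_ratio_def)
  then show ?case by (intro "0.prems"(1)[of "\<lambda>_. 1"]) (auto simp del: mult_1)
next
  case (Suc m)
  note fin = \<open>finite I\<close> and y = \<open>y \<in> garding (Suc m) I\<close>
  define r where "r x i = esym_ratio m (I - {i}) x" for x i
  have "\<forall>i\<in>I. \<exists>g. r y i = (\<Sum>j\<in>I - {i}. g j * y j) \<and>
      (\<forall>x\<in>garding m (I - {i}). r x i \<le> (\<Sum>j\<in>I - {i}. g j * x j))"
  proof
    fix i assume i: "i \<in> I"
    show "\<exists>g. r y i = (\<Sum>j\<in>I - {i}. g j * y j) \<and>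
        (\<forall>x\<in>garding m (I - {i}). r x i \<le> (\<Sum>j\<in>I - {i}. g j * x j))"
      by (rule Suc.IH[of "I - {i}"]) (use fin garding_remove[OF fin i y] in \<open>auto simp: r_def\<close>)
  qed
  then obtain h where h: "\<And>i. i \<in> I \<Longrightarrow> r y i = (\<Sum>j\<in>I - {i}. h i j * y j)"
    and h_le: "\<And>i x. i \<in> I \<Longrightarrow> x \<in> garding m (I - {i}) \<Longrightarrow> r x i \<le> (\<Sum>j\<in>I - {i}. h i j * x j)"
    by metis
  define \<theta> where "\<theta> i = y i / (y i + r y i)" for i
  \<comment> \<open>\<open>H i\<close> is the linear bound for the \<open>i\<close>-th parallel sum; \<open>g\<close> collects them\<close>
  define H where "H i j = (if j = i then (1 - \<theta> i)\<^sup>2 else (\<theta> i)\<^sup>2 * h i j)" for i j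
  define g where "g j = (\<Sum>i\<in>I. H i j) / real (Suc (Suc m))" for j
  have lin: "(1 - \<theta> i)\<^sup>2 * x i + (\<theta> i)\<^sup>2 * (\<Sum>j\<in>I - {i}. h i j * x j) = (\<Sum>j\<in>I. H i j * x j)"
    if "i \<in> I" for i x
    unfolding sum.remove[OF fin that] by (simp add: H_def sum_distrib_left algebra_simps)
  have g: "real (Suc (Suc m)) * (\<Sum>j\<in>I. g j * x j) = (\<Sum>i\<in>I. \<Sum>j\<in>I. H i j * x j)" for x
  proof -
    have "real (Suc (Suc m)) * (\<Sum>j\<in>I. g j * x j) = (\<Sum>j\<in>I. (\<Sum>i\<in>I. H i j) * x j)"
      unfolding sum_distrib_left by (intro sum.cong) (auto simp: g_def)
    also have "\<dots> = (\<Sum>j\<in>I. \<Sum>i\<in>I. H i j * x j)" by (simp add: sum_distrib_right)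
    finally show ?thesis by (subst sum.swap)
  qed
  have "real (Suc (Suc m)) * esym_ratio (Suc m) I y = (\<Sum>i\<in>I. \<Sum>j\<in>I. H i j * y j)"
    unfolding esym_ratio_Suc(2)[OF fin y] r_def[symmetric]
  proof (intro sum.cong refl)
    fix i assume i: "i \<in> I"
    show "y i * r y i / (y i + r y i) = (\<Sum>j\<in>I. H i j * y j)"
      using parallel_sum_eq[of "y i" "r y i"] esym_ratio_Suc(1)[OF fin y i] lin[OF i, of y] h[OF i]
      by (simp add: r_def \<theta>_def)
  qed
  then have eq: "real (Suc (Suc m)) * esym_ratio (Suc m) I y
      = real (Suc (Suc m)) * (\<Sum>j\<in>I. g j * y j)"
    unfolding g .
  have le: "real (Suc (Suc m)) * esym_ratio (Suc m) I x \<le> real (Suc (Suc m)) * (\<Sum>j\<in>I. g j * x j)"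
    if x: "x \<in> garding (Suc m) I" for x
    unfolding g esym_ratio_Suc(2)[OF fin x] r_def[symmetric]
  proof (intro sum_mono)
    fix i assume i: "i \<in> I"
    have "x i * r x i / (x i + r x i) \<le> (1 - \<theta> i)\<^sup>2 * x i + (\<theta> i)\<^sup>2 * r x i"
      using esym_ratio_Suc(1)[OF fin x i] by (intro parallel_sum_le) (simp add: r_def)
    also have "\<dots> \<le> (1 - \<theta> i)\<^sup>2 * x i + (\<theta> i)\<^sup>2 * (\<Sum>j\<in>I - {i}. h i j * x j)"
      by (intro add_left_mono mult_left_mono h_le i garding_remove[OF fin i x]) simp
    finally show "x i * r x i / (x i + r x i) \<le> (\<Sum>j\<in>I. H i j * x j)"
      unfolding lin[OF i] .
  qed
  show ?case
  proof (rule Suc.prems(1))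
    show "esym_ratio (Suc m) I y = (\<Sum>j\<in>I. g j * y j)"
      using eq by (subst (asm) mult_cancel_left) simp
    show "esym_ratio (Suc m) I x \<le> (\<Sum>j\<in>I. g j * x j)" if "x \<in> garding (Suc m) I" for x
      using le[OF that] by (subst (asm) mult_le_cancel_left_pos) auto
  qed
qed

section \<open>Linear functionals of doubly stochastic matrices\<close>

text \<open>
  Birkhoff's theorem, tested on a functional of rank one. Choose \<open>a\<close> with \<open>g\<close> minimal and \<open>b\<close> with \<open>l\<close>
  maximal and move mass until the entry \<open>(a, b)\<close> is 1: the mass \<open>u\<close> that row \<open>a\<close> and column \<open>b\<close> have
  elsewhere is sent to the entries \<open>(i, j)\<close> in proportion \<open>S\<^sub>i\<^sub>b S\<^sub>a\<^sub>j / u\<close>. The functional changes by a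
  nonnegative combination of the numbers \<open>(g\<^sub>i - g\<^sub>a) (l\<^sub>j - l\<^sub>b) \<le> 0\<close>, so it does not increase, and row \<open>a\<close> and
  column \<open>b\<close> can be removed.
\<close>

lemma doubly_stochastic_ge_permutation:
  fixes S :: "'i \<Rightarrow> 'j \<Rightarrow> real"
  assumes "finite I" "finite J" "card I = card J"
    and "\<And>i j. i \<in> I \<Longrightarrow> j \<in> J \<Longrightarrow> 0 \<le> S i j"
    and "\<And>i. i \<in> I \<Longrightarrow> (\<Sum>j\<in>J. S i j) = 1"
    and "\<And>j. j \<in> J \<Longrightarrow> (\<Sum>i\<in>I. S i j) = 1"
  shows "\<exists>s. bij_betw s I J \<and> (\<Sum>i\<in>I. g i * l (s i)) \<le> (\<Sum>i\<in>I. \<Sum>j\<in>J. S i j * (g i * l j))"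
  using assms
proof (induction "card I" arbitrary: I J S)
  case 0
  then show ?case by (auto simp: bij_betw_def)
next
  case (Suc n)
  note fI = \<open>finite I\<close> and fJ = \<open>finite J\<close>
  have "I \<noteq> {}" "J \<noteq> {}" using Suc.hyps(2) Suc.prems(3) by auto
  obtain a where a: "a \<in> I" "\<And>i. i \<in> I \<Longrightarrow> g a \<le> g i"
    using arg_min_if_finite[OF fI \<open>I \<noteq> {}\<close>, of g] by (meson not_le)
  obtain b where b: "b \<in> J" "\<And>j. j \<in> J \<Longrightarrow> l j \<le> l b"
    using arg_min_if_finite[OF fJ \<open>J \<noteq> {}\<close>, of "\<lambda>j. - l j"] by (meson neg_less_iff_less not_le)
  define I' J' where "I' = I - {a}" and "J' = J - {b}"
  have fI': "finite I'" and fJ': "finite J'" using fI fJ by (auto simp: I'_def J'_def)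
  have cards: "card I' = n" "card I' = card J'"
    using Suc.hyps(2) Suc.prems(3) a(1) b(1) fI fJ by (auto simp: I'_def J'_def)
  have sub: "\<And>i. i \<in> I' \<Longrightarrow> i \<in> I" "\<And>j. j \<in> J' \<Longrightarrow> j \<in> J" by (auto simp: I'_def J'_def)
  define u where "u = 1 - S a b"
  have row: "S i b + (\<Sum>j\<in>J'. S i j) = 1" if "i \<in> I" for i
    using Suc.prems(5)[OF that] sum.remove[OF fJ b(1), of "S i"] by (simp add: J'_def)
  have col: "S a j + (\<Sum>i\<in>I'. S i j) = 1" if "j \<in> J" for j
    using Suc.prems(6)[OF that] sum.remove[OF fI a(1), of "\<lambda>i. S i j"] by (simp add: I'_def)
  have rowa: "(\<Sum>j\<in>J'. S a j) = u" using row[OF a(1)] by (simp add: u_def)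
  have colb: "(\<Sum>i\<in>I'. S i b) = u" using col[OF b(1)] by (simp add: u_def)
  have nn: "\<And>i j. i \<in> I \<Longrightarrow> j \<in> J \<Longrightarrow> 0 \<le> S i j" by fact
  have u0: "0 \<le> u" unfolding rowa[symmetric] by (intro sum_nonneg nn a(1) sub)
  define T where "T i j = S i j + S i b * S a j / u" for i j
  have zero: "u = 0 \<Longrightarrow> i \<in> I' \<Longrightarrow> S i b = 0" "u = 0 \<Longrightarrow> j \<in> J' \<Longrightarrow> S a j = 0" for i j
    using colb rowa fI' fJ' nn a(1) b(1) sub by (auto simp: sum_nonneg_eq_0_iff)
  have Tnn: "0 \<le> T i j" if "i \<in> I'" "j \<in> J'" for i j
    unfolding T_def using that nn sub a(1) b(1) u0 by (intro add_nonneg_nonneg divide_nonneg_nonneg mult_nonneg_nonneg) auto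
  have Trow: "(\<Sum>j\<in>J'. T i j) = 1" if "i \<in> I'" for i
  proof -
    have "(\<Sum>j\<in>J'. T i j) = (\<Sum>j\<in>J'. S i j) + S i b * (\<Sum>j\<in>J'. S a j) / u"
      by (simp add: T_def sum.distrib sum_divide_distrib sum_distrib_left)
    also have "\<dots> = 1" using row[of i] sub(1)[OF that] zero(1)[OF _ that] rowa by (cases "u = 0") auto
    finally show ?thesis .
  qed
  have Tcol: "(\<Sum>i\<in>I'. T i j) = 1" if "j \<in> J'" for j
  proof -
    have "(\<Sum>i\<in>I'. T i j) = (\<Sum>i\<in>I'. S i j) + (\<Sum>i\<in>I'. S i b) * S a j / u"
      by (simp add: T_def sum.distrib sum_divide_distrib sum_distrib_right)
    also have "\<dots> = 1" using col[of j] sub(2)[OF that] zero(2)[OF _ that] colb by (cases "u = 0") auto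
    finally show ?thesis .
  qed
  obtain s where s: "bij_betw s I' J'"
    and s_le: "(\<Sum>i\<in>I'. g i * l (s i)) \<le> (\<Sum>i\<in>I'. \<Sum>j\<in>J'. T i j * (g i * l j))"
    using Suc.hyps(1)[OF cards(1)[symmetric] fI' fJ' cards(2) Tnn Trow Tcol] by blast
  define s' where "s' = s(a := b)"
  have "bij_betw s' I' J'"
    using s by (rule bij_betw_cong[THEN iffD1, rotated]) (auto simp: s'_def I'_def)
  then have "bij_betw s' (I' \<union> {a}) (J' \<union> {s' a})"
    by (intro notIn_Un_bij_betw) (auto simp: s'_def I'_def J'_def)
  then have bij: "bij_betw s' I J"
    using a(1) b(1) by (simp add: s'_def I'_def J'_def insert_absorb)
  \<comment> \<open>expand the products of differences; the row and column sums collapse three of the four terms\<close>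
  have cross: "(\<Sum>i\<in>I'. \<Sum>j\<in>J'. S i b * S a j / u * (g i * l j))
      \<le> (\<Sum>i\<in>I'. S i b * (g i * l b)) + (\<Sum>j\<in>J'. S a j * (g a * l j)) - u * (g a * l b)"
  proof (cases "u = 0")
    case True
    then show ?thesis using zero by simp
  next
    case False
    then have up: "u > 0" using u0 by simp
    have "0 \<le> (\<Sum>i\<in>I'. \<Sum>j\<in>J'. S i b * S a j / u * ((g i - g a) * (l b - l j)))"
      using a b nn sub up by (intro sum_nonneg mult_nonneg_nonneg divide_nonneg_pos) auto
    also have "\<dots> = (\<Sum>i\<in>I'. \<Sum>j\<in>J'. S a j / u * (S i b * (g i * l b))) + (\<Sum>i\<in>I'. \<Sum>j\<in>J'. S i b / u * (S a j * (g a * l j)))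
        - (\<Sum>i\<in>I'. \<Sum>j\<in>J'. S i b * S a j / u * (g a * l b)) - (\<Sum>i\<in>I'. \<Sum>j\<in>J'. S i b * S a j / u * (g i * l j))"
      unfolding sum.distrib[symmetric] sum_subtractf[symmetric]
      by (intro sum.cong refl) (simp add: add_divide_distrib diff_divide_distrib algebra_simps)
    also have "(\<Sum>i\<in>I'. \<Sum>j\<in>J'. S a j / u * (S i b * (g i * l b))) = (\<Sum>i\<in>I'. S i b * (g i * l b))"
      unfolding sum_distrib_right[symmetric] sum_divide_distrib[symmetric] rowa using up by simp
    also have "(\<Sum>i\<in>I'. \<Sum>j\<in>J'. S i b / u * (S a j * (g a * l j))) = (\<Sum>j\<in>J'. S a j * (g a * l j))"
      unfolding sum.swap[of _ J'] sum_distrib_right[symmetric] sum_divide_distrib[symmetric] colb using up by simp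
    also have "(\<Sum>i\<in>I'. \<Sum>j\<in>J'. S i b * S a j / u * (g a * l b)) = u * (g a * l b)"
      unfolding sum_distrib_right[symmetric] sum_divide_distrib[symmetric] sum_distrib_left[symmetric] rowa colb using up by simp
    finally show ?thesis by simp
  qed
  have "(\<Sum>i\<in>I. g i * l (s' i)) = g a * l b + (\<Sum>i\<in>I'. g i * l (s i))"
    unfolding sum.remove[OF fI a(1)] by (simp add: s'_def I'_def)
  also have "\<dots> \<le> g a * l b + (\<Sum>i\<in>I'. \<Sum>j\<in>J'. T i j * (g i * l j))" using s_le by simp
  also have "(\<Sum>i\<in>I'. \<Sum>j\<in>J'. T i j * (g i * l j))
      = (\<Sum>i\<in>I'. \<Sum>j\<in>J'. S i j * (g i * l j)) + (\<Sum>i\<in>I'. \<Sum>j\<in>J'. S i b * S a j / u * (g i * l j))"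
    by (simp add: T_def sum.distrib distrib_right)
  also have "g a * l b + \<dots> \<le> (1 - u) * (g a * l b) + (\<Sum>j\<in>J'. S a j * (g a * l j))
      + ((\<Sum>i\<in>I'. S i b * (g i * l b)) + (\<Sum>i\<in>I'. \<Sum>j\<in>J'. S i j * (g i * l j)))"
    using cross by (simp add: algebra_simps)
  also have "\<dots> = (\<Sum>i\<in>I. \<Sum>j\<in>J. S i j * (g i * l j))"
    unfolding sum.remove[OF fI a(1)] sum.remove[OF fJ b(1)] 
    by (simp add: I'_def[symmetric] J'_def[symmetric] sum.distrib u_def)
  finally show ?case using bij by blast
qed

section \<open>Orthonormal eigenbases of symmetric matrices\<close>

text \<open>
  A maximiser \<open>v\<close> of the quadratic form on the unit sphere of \<open>S\<close> is an eigenvector: the residue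
  \<open>w = f v - c v\<close> is orthogonal to \<open>v\<close>, and moving from \<open>v\<close> in the direction \<open>w\<close> changes the form to
  first order by \<open>2 \<langle>w, w\<rangle>\<close>, so \<open>w = 0\<close>.
\<close>

lemma invariant_subspace_has_eigenvector:
  fixes f :: "'a::euclidean_space \<Rightarrow> 'a"
  assumes lin: "linear f" and sym: "\<And>x y. f x \<bullet> y = x \<bullet> f y"
    and S: "subspace S" "f ` S \<subseteq> S" "S \<noteq> {0}"
  obtains v c where "v \<in> S" "norm v = 1" "f v = c *\<^sub>R v"
proof -
  let ?K = "S \<inter> sphere 0 1"
  have "compact ?K" by (intro closed_Int_compact closed_subspace S) simp
  moreover obtain y where y: "y \<in> S" "y \<noteq> 0" using S subspace_0 by blast
  then have "y /\<^sub>R norm y \<in> ?K" using S(1) by (simp add: subspace_scale)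
  then have "?K \<noteq> {}" by blast
  moreover have "continuous_on ?K (\<lambda>x. x \<bullet> f x)"
    by (intro continuous_intros linear_continuous_on_compose[OF _ lin])
  ultimately obtain v where v: "v \<in> ?K" and max: "\<And>x. x \<in> ?K \<Longrightarrow> x \<bullet> f x \<le> v \<bullet> f v"
    using continuous_attains_sup by metis
  define c where "c = v \<bullet> f v"
  have quad: "x \<bullet> f x \<le> c * (x \<bullet> x)" if "x \<in> S" for x
  proof (cases "x = 0")
    case True
    then show ?thesis by simp
  next
    case False
    have "x /\<^sub>R norm x \<in> ?K" using S(1) that False by (simp add: subspace_scale)
    from max[OF this] have "(x \<bullet> f x) / (norm x)\<^sup>2 \<le> c"
      by (simp add: linear_cmul[OF lin] c_def power2_eq_square divide_inverse ac_simps)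
    then show ?thesis using False by (simp add: divide_le_eq power2_norm_eq_inner)
  qed
  have vS: "v \<in> S" and vn: "v \<bullet> v = 1" using v by (auto simp: norm_eq_1)
  define w where "w = f v - c *\<^sub>R v"
  have wS: "w \<in> S" unfolding w_def using S vS by (auto intro: subspace_diff subspace_scale)
  have wv: "w \<bullet> v = 0" by (simp add: w_def inner_diff_left inner_diff_right vn c_def inner_commute)
  have wfv: "w \<bullet> f v = w \<bullet> w" 
  proof -
    have "w \<bullet> f v = w \<bullet> (w + c *\<^sub>R v)" by (simp add: w_def)
    then show ?thesis by (simp add: inner_add_right wv)
  qed
  have vfw: "v \<bullet> f w = w \<bullet> w" using sym[of v w] wfv by (simp add: inner_commute)
  have ineq: "2 * e * (w \<bullet> w) \<le> e\<^sup>2 * (c * (w \<bullet> w) - w \<bullet> f w)" for e :: real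
  proof -
    have "(v + e *\<^sub>R w) \<bullet> f (v + e *\<^sub>R w) = c + 2 * e * (w \<bullet> w) + e\<^sup>2 * (w \<bullet> f w)"
      using vfw wfv by (simp add: linear_add[OF lin] linear_cmul[OF lin] inner_add_left
        inner_add_right c_def power2_eq_square distrib_left)
    moreover have "(v + e *\<^sub>R w) \<bullet> (v + e *\<^sub>R w) = 1 + e\<^sup>2 * (w \<bullet> w)"
      by (simp add: inner_add_left inner_add_right vn wv inner_commute[of v w] power2_eq_square)
    moreover have "v + e *\<^sub>R w \<in> S" using S(1) vS wS by (simp add: subspace_add subspace_scale)
    ultimately show ?thesis using quad[of "v + e *\<^sub>R w"] by (simp add: algebra_simps)
  qed
  have "w \<bullet> w = 0"
  proof (rule ccontr)
    assume "w \<bullet> w \<noteq> 0"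
    then have p: "w \<bullet> w > 0" by simp
    define K where "K = \<bar>c * (w \<bullet> w) - w \<bullet> f w\<bar> + 1"
    have K: "K > 0" by (simp add: K_def)
    \<comment> \<open>small enough for the first-order gain to beat the second-order term\<close>
    define e where "e = (w \<bullet> w) / K"
    have e: "e > 0" using p K by (simp add: e_def)
    have "2 * e * (w \<bullet> w) \<le> e\<^sup>2 * K"
      using ineq[of e] by (rule order_trans) (intro mult_left_mono, auto simp: K_def)
    then have "2 * (w \<bullet> w) \<le> e * K" using e by (simp add: power2_eq_square)
    then show False using p K by (simp add: e_def)
  qed
  then have "f v = c *\<^sub>R v" by (simp add: w_def)
  with that vS vn show thesis by (simp add: norm_eq_1)
qed

text \<open>
  An orthonormal set of eigenvectors of maximal size spans the space, for otherwise its orthogonal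
  complement, which is invariant, would contain one more.
\<close>

lemma self_adjoint_orthonormal_eigenbasis:
  fixes f :: "'a::euclidean_space \<Rightarrow> 'a"
  assumes lin: "linear f" and sym: "\<And>x y. f x \<bullet> y = x \<bullet> f y"
  obtains B where "pairwise orthogonal B" "\<And>b. b \<in> B \<Longrightarrow> norm b = 1"
    "\<And>b. b \<in> B \<Longrightarrow> \<exists>c. f b = c *\<^sub>R b" "span B = UNIV" "finite B" "card B = DIM('a)"
proof -
  define Q where "Q B \<longleftrightarrow> pairwise orthogonal B \<and> (\<forall>b\<in>B. norm b = 1 \<and> (\<exists>c. f b = c *\<^sub>R b))" for B :: "'a set"
  have ind: "independent B" if "Q B" for B
    using that unfolding Q_def by (intro pairwise_orthogonal_independent) auto
  have bound: "card B \<le> DIM('a)" "finite B" if "Q B" for B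
    using independent_bound[OF ind[OF that]] by auto
  have "Q {}" by (simp add: Q_def)
  then obtain B where B: "Q B" and max: "\<And>B'. Q B' \<Longrightarrow> card B' \<le> card B"
    using bound(1) ex_has_greatest_nat[of Q "{}" card "Suc DIM('a)"] by (auto simp: less_Suc_eq_le)
  define S where "S = orthogonal_comp (span B)"
  have S: "x \<in> S \<longleftrightarrow> (\<forall>b\<in>B. b \<bullet> x = 0)" for x
  proof -
    have "x \<in> S \<longleftrightarrow> (\<forall>b\<in>span B. orthogonal x b)"
      by (simp add: S_def orthogonal_comp_def orthogonal_commute)
    also have "\<dots> \<longleftrightarrow> (\<forall>b\<in>B. orthogonal x b)"
      by (meson orthogonal_to_span span_base)
    finally show ?thesis by (simp add: orthogonal_def inner_commute)
  qed
  have "S = {0}"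
  proof (rule ccontr)
    assume "S \<noteq> {0}"
    moreover have "subspace S" unfolding S_def by (rule subspace_orthogonal_comp)
    moreover have "f ` S \<subseteq> S"
    proof safe
      fix x assume x: "x \<in> S"
      have "b \<bullet> f x = 0" if b: "b \<in> B" for b
      proof -
        obtain c where "f b = c *\<^sub>R b" using B b by (auto simp: Q_def)
        then have "b \<bullet> f x = c * (b \<bullet> x)" using sym[of b x] by simp
        then show ?thesis using x b by (simp add: S)
      qed
      then show "f x \<in> S" by (simp add: S)
    qed
    ultimately obtain v c where v: "v \<in> S" "norm v = 1" "f v = c *\<^sub>R v"
      using invariant_subspace_has_eigenvector[OF lin sym] by metis
    have "v \<notin> B" using v(1,2) by (auto simp: S)
    then have "card (insert v B) = Suc (card B)" using bound(2)[OF B] by simp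
    moreover have "Q (insert v B)"
      using B v unfolding Q_def
      by (auto simp: pairwise_insert orthogonal_def S inner_commute)
    ultimately show False using max by fastforce
  qed
  have span: "span B = UNIV"
  proof (rule ccontr)
    assume "span B \<noteq> UNIV"
    then have "span B < UNIV" by blast
    then obtain a where a: "a \<noteq> 0" "\<And>x. x \<in> span B \<Longrightarrow> a \<bullet> x = 0"
      using span_not_univ_subset_hyperplane[of B] by blast
    have "a \<in> S" unfolding S using a(2) by (simp add: span_base inner_commute)
    with \<open>S = {0}\<close> a(1) show False by simp
  qed
  have "card B = DIM('a)"
    using ind[OF B] span by (metis dim_UNIV dim_span_eq_card_independent)
  moreover have "pairwise orthogonal B" "\<And>b. b \<in> B \<Longrightarrow> norm b = 1"
    "\<And>b. b \<in> B \<Longrightarrow> \<exists>c. f b = c *\<^sub>R b"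
    using B unfolding Q_def by blast+
  ultimately show thesis
    using span bound(2)[OF B] by (intro that[of B])
qed

definition eigenbasis :: "real^'d^'d \<Rightarrow> ('d \<Rightarrow> real^'d) \<Rightarrow> ('d \<Rightarrow> real) \<Rightarrow> bool" where
  "eigenbasis w v c \<longleftrightarrow> (\<forall>i j. v i \<bullet> v j = (if i = j then 1 else 0)) \<and> (\<forall>i. w *v v i = c i *\<^sub>R v i)"

lemma eigenbasis_exists:
  fixes w :: "real^'d^'d"
  assumes "transpose w = w"
  obtains v c where "eigenbasis w v c"
proof -
  have "(w *v x) \<bullet> y = x \<bullet> (w *v y)" for x y
    using assms by (metis dot_lmul_matrix vector_transpose_matrix)
  then obtain B where B: "pairwise orthogonal B" "\<And>b. b \<in> B \<Longrightarrow> norm b = 1"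
    "\<And>b. b \<in> B \<Longrightarrow> \<exists>c. w *v b = c *\<^sub>R b" "finite B" "card B = CARD('d)"
    using self_adjoint_orthonormal_eigenbasis[OF matrix_vector_mul_linear[of w]] by (metis DIM_cart DIM_real mult.right_neutral)
  obtain v where v: "bij_betw v (UNIV :: 'd set) B"
    using finite_same_card_bij[of "UNIV :: 'd set" B] B(4,5) by auto
  then have vB: "v i \<in> B" for i by (auto simp: bij_betw_def)
  obtain c where "\<And>i. w *v v i = c i *\<^sub>R v i" using B(3)[OF vB] by metis
  moreover have "v i \<bullet> v j = (if i = j then 1 else 0)" for i j
  proof (cases "i = j")
    case True
    then show ?thesis using B(2)[OF vB, of i] by (simp add: norm_eq_1)
  next
    case False
    then have "v i \<noteq> v j" using v by (auto simp: bij_betw_def inj_on_def)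
    then show ?thesis using B(1) vB False by (auto simp: pairwise_def orthogonal_def)
  qed
  ultimately show thesis using that unfolding eigenbasis_def by blast
qed

lemma eigenbasis_expand:
  assumes "eigenbasis w v c"
  shows "(\<Sum>i\<in>UNIV. (x \<bullet> v i) *\<^sub>R v i) = x"
proof -
  have on: "v i \<bullet> v j = (if i = j then 1 else 0)" for i j using assms by (simp add: eigenbasis_def)
  have inj: "inj v" by (metis injI on zero_neq_one)
  have po: "pairwise orthogonal (range v)"
    using on by (auto simp: pairwise_def orthogonal_def)
  have n1: "norm b = 1" if "b \<in> range v" for b using that on by (auto simp: norm_eq_1)
  then have "0 \<notin> range v" by (metis norm_zero zero_neq_one)
  then have "independent (range v)" using po by (intro pairwise_orthogonal_independent)
  moreover have "card (range v) = CARD('a)" using inj by (simp add: card_image)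
  ultimately have "span (range v) = UNIV"
    by (metis card_ge_dim_independent dim_UNIV DIM_cart DIM_real mult.right_neutral order_refl subset_UNIV top.extremum_uniqueI)
  then have "(\<Sum>b\<in>range v. (x \<bullet> b) *\<^sub>R b) = x"
    using orthonormal_basis_expand[OF po n1, of x] by auto
  then show ?thesis by (simp add: sum.reindex[OF inj])
qed

section \<open>Concavity of the ratios on symmetric matrices\<close>

lemma esym_eq_sum_prod:
  assumes "finite I"
  shows "esym k I x = (\<Sum>K | K \<subseteq> I \<and> card K = k. \<Prod>i\<in>K. x i)"
proof -
  have "(\<Prod>i\<in>I. [:1, x i:]) = (\<Prod>i\<in>I. [:0, x i:] + 1)"
    by (intro prod.cong refl) (simp add: one_pCons)
  also have "\<dots> = (\<Sum>K\<in>Pow I. (\<Prod>i\<in>K. [:0, x i:]) * (\<Prod>i\<in>I - K. 1))"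
    by (rule prod_add[OF assms])
  also have "\<dots> = (\<Sum>K\<in>Pow I. monom (\<Prod>i\<in>K. x i) (card K))"
  proof (intro sum.cong refl)
    fix K assume "K \<in> Pow I"
    then have "finite K" using assms finite_subset by auto
    then have "(\<Prod>i\<in>K. [:0, x i:]) = monom (\<Prod>i\<in>K. x i) (card K)"
      by (induction K) (auto simp: mult_monom monom_Suc one_pCons simp flip: smult_monom)
    then show "(\<Prod>i\<in>K. [:0, x i:]) * (\<Prod>i\<in>I - K. 1) = monom (\<Prod>i\<in>K. x i) (card K)" by simp
  qed
  finally have "esym k I x = (\<Sum>K\<in>Pow I. if card K = k then \<Prod>i\<in>K. x i else 0)"
    by (simp add: esym_def coeff_sum)
  also have "\<dots> = (\<Sum>K | K \<in> Pow I \<and> card K = k. \<Prod>i\<in>K. x i)"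
    by (rule sum.inter_filter[symmetric]) (simp add: assms)
  finally show ?thesis by simp
qed

lemma elem_sym_eq_coeff:
  fixes xs :: "real list"
  shows
  "elem_sym k xs = coeff (prod_mset (image_mset (\<lambda>x. [:1, x:]) (mset xs))) k"
proof -
  have "elem_sym k xs = esym k {..<length xs} (\<lambda>i. xs ! i)"
    unfolding elem_sym_def by (simp add: esym_eq_sum_prod)
  also have "(\<Prod>i<length xs. [:1, xs ! i:]) = prod_list (map (\<lambda>x. [:1, x:]) xs)"
    unfolding prod.list_conv_set_nth by (simp add: atLeast0LessThan)
  then have "esym k {..<length xs} (\<lambda>i. xs ! i) = coeff (prod_list (map (\<lambda>x. [:1, x:]) xs)) k"
    by (simp add: esym_def)
  finally show ?thesis by (metis mset_map prod_mset_prod_list)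
qed

text \<open>
  Conjugation with the orthogonal matrix of eigenvectors diagonalises \<open>a + b w\<close>. The two parameters serve
  both the characteristic polynomial (\<open>b = -1\<close>) and the generating function of the \<open>P\<^sub>k\<close> (\<open>a = 1\<close>).
\<close>

lemma det_shift:
  fixes w :: "real^'d^'d"
  assumes "eigenbasis w v c"
  shows "det (\<chi> i j. (if i = j then a else 0) + b * w $ i $ j) = (\<Prod>i\<in>UNIV. a + b * c i)"
proof -
  define M where "M = (\<chi> i j. (if i = j then a else 0) + b * w $ i $ j)"
  define V where "V = (\<chi> i j. v j $ i)"
  have on: "v i \<bullet> v j = (if i = j then 1 else 0)" for i j using assms by (simp add: eigenbasis_def)
  have ev: "w *v v i = c i *\<^sub>R v i" for i using assms by (simp add: eigenbasis_def)
  have MV: "M *v x = a *\<^sub>R x + b *\<^sub>R (w *v x)" for x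
    by (simp add: M_def vec_eq_iff matrix_vector_mult_def distrib_right sum.distrib sum_distrib_left
      mult.assoc if_distrib[of "\<lambda>t. t * _"] cong: if_cong)
  have orth: "transpose V ** V = mat 1"
    using on by (simp add: vec_eq_iff matrix_matrix_mult_def transpose_def V_def mat_def inner_vec_def)
  have "(transpose V ** (M ** V)) $ i $ j = v i \<bullet> (M *v v j)" for i j
    by (simp add: matrix_matrix_mult_def matrix_vector_mult_def transpose_def V_def inner_vec_def)
  also have "v i \<bullet> (M *v v j) = (if i = j then a + b * c i else 0)" for i j
    by (simp add: MV ev inner_add_right on)
  finally have "det (transpose V ** (M ** V)) = (\<Prod>i\<in>UNIV. a + b * c i)"
    by (subst det_diagonal) simp_all
  moreover have "det (transpose V) * det V = 1"
    using arg_cong[OF orth, of det] by (simp only: det_mul det_I)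
  ultimately show ?thesis
    unfolding M_def[symmetric] by (simp add: det_mul) (metis mult.assoc mult.commute mult.right_neutral)
qed

lemma poly_ext: "(\<And>x. poly p x = poly q x) \<Longrightarrow> p = q" for p q :: "real poly"
  by (metis ext poly_eq_poly_eq_iff)

lemma poly_det: "poly (det P) x = det (\<chi> i j. poly (P $ i $ j) x)"
  for P :: "real poly^'d^'d"
  by (simp add: det_def poly_sum poly_prod)

lemma charpoly_eigenbasis:
  fixes w :: "real^'d^'d"
  assumes "eigenbasis w v c"
  shows "charpoly w = (\<Prod>i\<in>UNIV. [:- c i, 1:])"
proof -
  have "poly (charpoly w) x = poly (\<Prod>i\<in>UNIV. [:- c i, 1:]) x" for x
  proof -
    have "poly (charpoly w) x = det (\<chi> i j. (if i = j then x else 0) + (-1) * w $ i $ j)"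
      unfolding charpoly_def poly_det by (intro arg_cong[of _ _ det]) (simp add: vec_eq_iff mat_def)
    then show ?thesis unfolding det_shift[OF assms] by (simp add: poly_prod)
  qed
  then show ?thesis by (rule poly_ext)
qed

lemma P_sym_eigenbasis:
  fixes w :: "real^'d^'d"
  assumes "eigenbasis w v c"
  shows "P_sym k w = esym k UNIV c"
proof -
  have "proots (charpoly w) = image_mset c (mset_set UNIV)"
    unfolding charpoly_eigenbasis[OF assms]
    by (subst proots_prod) (auto simp: sum_unfold_sum_mset)
  then have "mset (eigenvalues w) = image_mset c (mset_set UNIV)"
    by (simp add: eigenvalues_def)
  then show ?thesis
    unfolding P_sym_def elem_sym_eq_coeff esym_def
    by (simp add: prod_unfold_prod_mset multiset.map_comp o_def)
qed

text \<open>
  Unlike the list of eigenvalues, this expression is visibly polynomial, hence continuous, in the entries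
  of \<open>w\<close>.
\<close>

lemma P_sym_eq_coeff_det:
  fixes w :: "real^'d^'d"
  assumes "transpose w = w"
  shows "P_sym k w = coeff (det (\<chi> i j. [:if i = j then 1 else 0, w $ i $ j:])) k"
proof -
  obtain v c where vc: "eigenbasis w v c" using eigenbasis_exists[OF assms] .
  have "poly (det (\<chi> i j. [:if i = j then 1 else 0, w $ i $ j:])) x
      = poly (\<Prod>i\<in>UNIV. [:1, c i:]) x" for x
    using det_shift[OF vc, of 1 x] by (simp add: poly_det poly_prod)
  then have "det (\<chi> i j. [:if i = j then 1 else 0, w $ i $ j:]) = (\<Prod>i\<in>UNIV. [:1, c i:])"
    by (rule poly_ext)
  then show ?thesis by (simp add: P_sym_eigenbasis[OF vc] esym_def)
qed

lemma continuous_on_coeff_prod: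
  assumes "\<And>i k. i \<in> I \<Longrightarrow> continuous_on S (\<lambda>w. coeff (p i w) k :: real)"
  shows "continuous_on S (\<lambda>w. coeff (\<Prod>i\<in>I. p i w) k)"
  using assms
proof (induction I arbitrary: k rule: infinite_finite_induct)
  case (insert i I)
  then show ?case by (auto simp: coeff_mult intro!: continuous_intros)
qed auto

lemma continuous_on_P_sym:
  "continuous_on {w :: real^'d^'d. transpose w = w} (P_sym k)"
proof -
  have "continuous_on {w :: real^'d^'d. transpose w = w}
      (\<lambda>w. coeff (det (\<chi> i j. [:if i = j then 1 else 0, w $ i $ j:])) k)"
    unfolding det_def coeff_sum
  proof (intro continuous_on_sum)
    fix s :: "'d \<Rightarrow> 'd"
    have c: "coeff (of_int (sign s) * q) k = of_int (sign s) * coeff q k" for q :: "real poly"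
      by (simp add: of_int_poly)
    have "continuous_on {w :: real^'d^'d. transpose w = w}
        (\<lambda>w. coeff [:if i = s i then 1 else 0, w $ i $ s i:] n)" for i n
      by (cases n; cases "n - 1") (auto intro!: continuous_intros)
    then show "continuous_on {w :: real^'d^'d. transpose w = w}
        (\<lambda>w. coeff (of_int (sign s) * (\<Prod>i\<in>UNIV. (\<chi> i j. [:if i = j then 1 else 0, w $ i $ j:]) $ i $ s i)) k)"
      unfolding c by (intro continuous_intros continuous_on_coeff_prod) simp
  qed
  then show ?thesis by (rule continuous_on_cong[THEN iffD1, rotated 2]) (simp_all add: P_sym_eq_coeff_det)
qed

definition garding_cone :: "nat \<Rightarrow> (real^'d^'d) set" where
  "garding_cone m = {w. transpose w = w \<and> (\<forall>k\<le>m. 0 < P_sym k w)}"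

definition P_ratio :: "nat \<Rightarrow> real^'d^'d \<Rightarrow> real" where
  "P_ratio m w = P_sym (Suc m) w / P_sym m w"

lemma garding_cone_antimono: "k \<le> m \<Longrightarrow> garding_cone m \<subseteq> garding_cone k"
  by (auto simp: garding_cone_def)

lemma eigenbasis_quadratic_form:
  assumes "eigenbasis A u l"
  shows "x \<bullet> (A *v x) = (\<Sum>j\<in>UNIV. (x \<bullet> u j)\<^sup>2 * l j)"
    and "x \<bullet> x = (\<Sum>j\<in>UNIV. (x \<bullet> u j)\<^sup>2)"
proof -
  note ex = eigenbasis_expand[OF assms, of x]
  have "A *v x = A *v (\<Sum>j\<in>UNIV. (x \<bullet> u j) *\<^sub>R u j)" by (simp only: ex)
  also have "\<dots> = (\<Sum>j\<in>UNIV. (x \<bullet> u j) *\<^sub>R (l j *\<^sub>R u j))"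
    using assms by (simp add: linear_sum[OF matrix_vector_mul_linear] linear_cmul[OF matrix_vector_mul_linear] eigenbasis_def)
  finally show "x \<bullet> (A *v x) = (\<Sum>j\<in>UNIV. (x \<bullet> u j)\<^sup>2 * l j)"
    by (simp add: inner_sum_right power2_eq_square mult_ac)
  have "x \<bullet> x = x \<bullet> (\<Sum>j\<in>UNIV. (x \<bullet> u j) *\<^sub>R u j)" by (simp only: ex)
  then show "x \<bullet> x = (\<Sum>j\<in>UNIV. (x \<bullet> u j)\<^sup>2)"
    by (simp add: inner_sum_right power2_eq_square)
qed

text \<open>
  Davis's argument: the diagonal of \<open>A\<close> in the eigenbasis \<open>v\<close> of \<open>M\<close> is \<open>S l\<close>, where \<open>l\<close> are the eigenvalues
  of \<open>A\<close> and \<open>S\<^sub>i\<^sub>j = \<langle>v\<^sub>i, u\<^sub>j\<rangle>\<^sup>2\<close> is doubly stochastic. The value of the supporting functional at \<open>S l\<close> is at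
  least its value at some permutation of \<open>l\<close>, where the bound for vectors applies.
\<close>

lemma P_ratio_support:
  fixes M :: "real^'d^'d"
  assumes "M \<in> garding_cone m"
  obtains L where "linear L" "P_ratio m M = L M" "\<And>A. A \<in> garding_cone m \<Longrightarrow> P_ratio m A \<le> L A"
proof -
  obtain v c where vc: "eigenbasis M v c"
    using assms eigenbasis_exists unfolding garding_cone_def by blast
  have "c \<in> garding m UNIV"
    using assms by (simp add: garding_cone_def garding_def P_sym_eigenbasis[OF vc])
  then obtain g where g: "esym_ratio m UNIV c = (\<Sum>i\<in>UNIV. g i * c i)"
    and g_le: "\<And>x. x \<in> garding m UNIV \<Longrightarrow> esym_ratio m UNIV x \<le> (\<Sum>i\<in>UNIV. g i * x i)"
    using esym_ratio_support[of UNIV c m] by auto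
  define L where "L A = (\<Sum>i\<in>UNIV. g i * (v i \<bullet> (A *v v i)))" for A
  show thesis
  proof (rule that[of L])
    show "linear L"
      by (intro linearI) (simp_all add: L_def matrix_vector_mult_add_rdistrib inner_add_right distrib_left
        sum.distrib scaleR_matrix_vector_assoc[symmetric] sum_distrib_left mult_ac)
    have "v i \<bullet> (M *v v i) = c i" for i using vc by (simp add: eigenbasis_def)
    then show "P_ratio m M = L M"
      using g by (simp add: L_def P_ratio_def esym_ratio_def P_sym_eigenbasis[OF vc])
    fix A :: "real^'d^'d" assume A: "A \<in> garding_cone m"
    then obtain u l where ul: "eigenbasis A u l"
      using eigenbasis_exists unfolding garding_cone_def by blast
    define S where "S i j = (v i \<bullet> u j)\<^sup>2" for i j
    have "(\<Sum>j\<in>UNIV. S i j) = 1" for i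
      using eigenbasis_quadratic_form(2)[OF ul, of "v i"] vc by (simp add: S_def eigenbasis_def)
    moreover have "(\<Sum>i\<in>UNIV. S i j) = 1" for j
      using eigenbasis_quadratic_form(2)[OF vc, of "u j"] ul by (simp add: S_def eigenbasis_def inner_commute)
    moreover have "0 \<le> S i j" for i j by (simp add: S_def)
    ultimately obtain s where s: "bij_betw s (UNIV :: 'd set) (UNIV :: 'd set)"
      and s_le: "(\<Sum>i\<in>UNIV. g i * l (s i)) \<le> (\<Sum>i\<in>UNIV. \<Sum>j\<in>UNIV. S i j * (g i * l j))"
      using doubly_stochastic_ge_permutation[of UNIV UNIV S g l] by auto
    have e: "esym k UNIV (\<lambda>i. l (s i)) = P_sym k A" for k
      by (simp add: esym_reindex[OF s] P_sym_eigenbasis[OF ul])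
    have "(\<lambda>i. l (s i)) \<in> garding m UNIV"
      using A by (simp add: garding_cone_def garding_def e)
    from g_le[OF this] s_le have "P_ratio m A \<le> (\<Sum>i\<in>UNIV. \<Sum>j\<in>UNIV. S i j * (g i * l j))"
      by (simp add: esym_ratio_def e P_ratio_def)
    also have "\<dots> = L A"
      by (simp add: L_def eigenbasis_quadratic_form(1)[OF ul] S_def sum_distrib_left mult_ac)
    finally show "P_ratio m A \<le> L A" .
  qed
qed

lemma P_ratio_concave:
  fixes A B :: "real^'d^'d"
  assumes "A \<in> garding_cone m" "B \<in> garding_cone m" "0 \<le> t" "t \<le> 1"
    and "(1 - t) *\<^sub>R A + t *\<^sub>R B \<in> garding_cone m"
  shows "(1 - t) * P_ratio m A + t * P_ratio m B \<le> P_ratio m ((1 - t) *\<^sub>R A + t *\<^sub>R B)"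
proof -
  obtain L where L: "linear L" "P_ratio m ((1 - t) *\<^sub>R A + t *\<^sub>R B) = L ((1 - t) *\<^sub>R A + t *\<^sub>R B)"
    "\<And>X. X \<in> garding_cone m \<Longrightarrow> P_ratio m X \<le> L X"
    using P_ratio_support[OF assms(5)] by blast
  have "(1 - t) * P_ratio m A + t * P_ratio m B \<le> (1 - t) * L A + t * L B"
    using assms(3,4) L(3)[OF assms(1)] L(3)[OF assms(2)] by (intro add_mono mult_left_mono) auto
  then show ?thesis unfolding L(2) by (simp add: linear_add[OF L(1)] linear_cmul[OF L(1)])
qed

lemma P_ratio_pos:
  assumes "w \<in> garding_cone m" "k < m"
  shows "0 < P_ratio k w"
  using assms by (simp add: garding_cone_def P_ratio_def)

text \<open>
  If the segment lies in the cone of degree \<open>m\<close>, then the ratio \<open>P\<^sub>m\<^sub>+\<^sub>1 / P\<^sub>m\<close> is concave along it; being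
  positive at both ends, it is positive throughout.
\<close>

lemma garding_cone_segment:
  fixes A B :: "real^'d^'d"
  assumes "A \<in> garding_cone m" "B \<in> garding_cone m" "0 \<le> t" "t \<le> 1"
  shows "(1 - t) *\<^sub>R A + t *\<^sub>R B \<in> garding_cone m"
  using assms(1,2)
proof (induction m)
  case 0
  let ?M = "(1 - t) *\<^sub>R A + t *\<^sub>R B"
  have t: "transpose ?M = ?M"
    using 0 by (auto simp: garding_cone_def vec_eq_iff transpose_def)
  then obtain v c where "eigenbasis ?M v c" using eigenbasis_exists by blast
  then show ?case using t by (simp add: garding_cone_def P_sym_eigenbasis)
next
  case (Suc m)
  let ?M = "(1 - t) *\<^sub>R A + t *\<^sub>R B"
  have AB: "A \<in> garding_cone m" "B \<in> garding_cone m"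
    using Suc.prems garding_cone_antimono[of m "Suc m"] by auto
  have M: "?M \<in> garding_cone m" using Suc.IH AB .
  have "0 < (1 - t) * P_ratio m A + t * P_ratio m B"
    using P_ratio_pos[OF Suc.prems(1), of m] P_ratio_pos[OF Suc.prems(2), of m] assms(3,4)
    by (cases "t = 0") (auto intro: add_nonneg_pos)
  also have "\<dots> \<le> P_ratio m ?M" by (rule P_ratio_concave[OF AB assms(3,4) M])
  finally have "0 < P_sym (Suc m) ?M"
    using M by (simp add: P_ratio_def garding_cone_def zero_less_divide_iff)
      (metis order_refl order_less_asym)
  then show ?case using M by (auto simp: garding_cone_def le_Suc_eq)
qed

section \<open>The connected component is the cone of positive symmetric functions\<close>

lemma mat_1_in_garding_cone:
  assumes "m \<le> CARD('d)"
  shows "(mat 1 :: real^'d^'d) \<in> garding_cone m"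
proof -
  have "eigenbasis (mat 1 :: real^'d^'d) (\<lambda>i. axis i 1) (\<lambda>_. 1)"
    by (auto simp: eigenbasis_def inner_axis_axis)
  from P_sym_eigenbasis[OF this]
  have "P_sym k (mat 1 :: real^'d^'d) = real (CARD('d) choose k)" for k
    using n_subsets[of "UNIV :: 'd set" k] by (simp add: esym_eq_sum_prod)
  then show ?thesis using assms by (auto simp: garding_cone_def transpose_mat)
qed

lemma P_sym_Suc_le:
  fixes w :: "real^'d^'d"
  assumes "w \<in> garding_cone k"
  shows "P_sym (Suc k) w \<le> P_sym 1 w * P_sym k w"
proof -
  obtain v c where vc: "eigenbasis w v c"
    using assms eigenbasis_exists unfolding garding_cone_def by blast
  have "c \<in> garding k UNIV"
    using assms by (simp add: garding_cone_def garding_def P_sym_eigenbasis[OF vc])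
  from esym_Suc_le[OF finite this] show ?thesis unfolding P_sym_eigenbasis[OF vc] .
qed

text \<open>
  Within \<open>{P\<^sub>m > 0}\<close> the cone is also given by non-strict inequalities: reading \<open>P\<^sub>k\<^sub>+\<^sub>1 \<le> P\<^sub>1 P\<^sub>k\<close> from
  \<open>k = m - 1\<close> downwards excludes that some \<open>P\<^sub>k\<close> vanishes. The cone is therefore relatively closed.
\<close>

lemma garding_cone_eq_closed_condition:
  fixes w :: "real^'d^'d"
  assumes "transpose w = w" "0 < P_sym m w"
  shows "w \<in> garding_cone m \<longleftrightarrow>
    (\<forall>k<m. 0 \<le> P_sym k w \<and> P_sym (Suc k) w \<le> P_sym 1 w * P_sym k w)"
proof
  assume w: "w \<in> garding_cone m"
  show "\<forall>k<m. 0 \<le> P_sym k w \<and> P_sym (Suc k) w \<le> P_sym 1 w * P_sym k w"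
  proof (intro allI impI conjI)
    fix k assume k: "k < m"
    then have wk: "w \<in> garding_cone k" using w garding_cone_antimono[of k m] by auto
    then show "0 \<le> P_sym k w" by (auto simp: garding_cone_def less_imp_le)
    show "P_sym (Suc k) w \<le> P_sym 1 w * P_sym k w" by (rule P_sym_Suc_le[OF wk])
  qed
next
  assume *: "\<forall>k<m. 0 \<le> P_sym k w \<and> P_sym (Suc k) w \<le> P_sym 1 w * P_sym k w"
  have "0 < P_sym k w" if "k \<le> m" for k
    using that
  proof (induction rule: inc_induct)
    case (step k)
    then have "0 \<le> P_sym k w" "P_sym (Suc k) w \<le> P_sym 1 w * P_sym k w" using * by auto
    then show ?case using step.IH by (cases "P_sym k w = 0") auto
  qed (rule assms(2))
  then show "w \<in> garding_cone m" using assms(1) by (simp add: garding_cone_def)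
qed

text \<open>
  The cone is convex and contains the identity, so it lies in the component; being relatively open and
  closed, it contains the component.
\<close>

lemma C_cone_eq_garding_cone:
  assumes "0 < m" "m \<le> CARD('d)"
  shows "C_cone m = (garding_cone m :: (real^'d^'d) set)"
proof
  let ?T = "{w :: real^'d^'d. transpose w = w \<and> P_sym m w > 0}"
  have one: "mat 1 \<in> (garding_cone m :: (real^'d^'d) set)" by (rule mat_1_in_garding_cone[OF assms(2)])
  have sub: "garding_cone m \<subseteq> ?T" by (auto simp: garding_cone_def)
  have "convex (garding_cone m :: (real^'d^'d) set)"
    unfolding convex_alt using garding_cone_segment by blast
  then show "garding_cone m \<subseteq> (C_cone m :: (real^'d^'d) set)"
    unfolding C_cone_def
    using one sub by (intro connected_component_maximal convex_connected)
  show "(C_cone m :: (real^'d^'d) set) \<subseteq> garding_cone m"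
  proof -
    define K where "K = (C_cone m :: (real^'d^'d) set)"
    have KT: "K \<subseteq> ?T" unfolding K_def C_cone_def by (rule connected_component_subset)
    have conn: "connected K" unfolding K_def C_cone_def by (rule connected_connected_component)
    have cont: "continuous_on K (P_sym k)" for k
      using KT by (intro continuous_on_subset[OF continuous_on_P_sym]) auto
    have "garding_cone m \<inter> K = (\<Inter>k\<in>{..m}. K \<inter> P_sym k -` {0<..})"
      using KT by (auto simp: garding_cone_def)
    also have "openin (top_of_set K) \<dots>"
      by (intro openin_INT2 continuous_openin_preimage_gen cont) auto
    finally have op: "openin (top_of_set K) (garding_cone m \<inter> K)" .
    \<comment> \<open>the minimum merges the two non-strict inequalities into one continuous function\<close>
    define h where "h k w = min (P_sym k w) (P_sym 1 w * P_sym k w - P_sym (Suc k) w)"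
      for k and w :: "real^'d^'d"
    have "garding_cone m \<inter> K = (\<Inter>k\<in>{..<m}. K \<inter> h k -` {0..})"
    proof -
      have "w \<in> garding_cone m \<longleftrightarrow> (\<forall>k<m. 0 \<le> h k w)" if "w \<in> K" for w
        using KT that garding_cone_eq_closed_condition[of w m] by (auto simp: h_def)
      then show ?thesis using assms(1) by auto
    qed
    also have "closedin (top_of_set K) \<dots>"
      unfolding h_def using assms(1)
      by (intro closedin_INT continuous_closedin_preimage continuous_intros cont) auto
    finally have cl: "closedin (top_of_set K) (garding_cone m \<inter> K)" .
    have "mat 1 \<in> garding_cone m \<inter> K"
      using one sub unfolding K_def C_cone_def by (auto intro: connected_component_refl)
    then have "garding_cone m \<inter> K = K"
      using conn op cl unfolding connected_clopen by blast
    then show ?thesis unfolding K_def by blast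
  qed
qed

section \<open>Quasiconvexity\<close>

text \<open>
  The arithmetic-geometric mean inequality for the numbers \<open>q\<^sub>j\<close> together with \<open>X\<^sup>p\<^sup>+\<^sup>1 / \<Prod>q\<^sub>j\<close>, whose
  product is \<open>X\<^sup>p\<^sup>+\<^sup>1\<close>. It is the tangent plane of \<open>X\<^sup>p\<^sup>+\<^sup>1 / \<Prod>q\<^sub>j\<close> at the point \<open>(1, \<dots>, 1)\<close>.
\<close>

lemma power_over_prod_ge_tangent:
  fixes X :: real
  assumes "finite J" "0 \<le> X" "\<And>j. j \<in> J \<Longrightarrow> 0 < q j"
  shows "real (Suc (card J)) * X \<le> X ^ Suc (card J) / prod q J + sum q J"
proof (cases "X = 0")
  case True
  then show ?thesis using assms(3) by (simp add: sum_nonneg less_imp_le)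
next
  case False
  then have X: "0 < X" using assms(2) by simp
  let ?n = "Suc (card J)"
  have q: "0 < prod q J" by (intro prod_pos assms(3))
  define a where "a i = (case i of None \<Rightarrow> X ^ ?n / prod q J | Some j \<Rightarrow> q j)" for i
  define S where "S = insert None (Some ` J)"
  have cS: "card S = ?n" using assms(1) by (simp add: S_def card_image)
  have sS: "sum a S = X ^ ?n / prod q J + sum q J"
    using assms(1) by (simp add: S_def a_def sum.reindex)
  have "prod a S = X ^ ?n / prod q J * prod q J"
    using assms(1) by (simp add: S_def a_def prod.reindex)
  then have pS: "prod a S = X ^ ?n" using q by (metis less_irrefl nonzero_eq_divide_eq)
  have "prod a S powr (1 / card S) \<le> (\<Sum>i\<in>S. a i / card S)"
    using assms X q by (intro arith_geom_mean) (auto simp: S_def a_def less_imp_le)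
  also have "(\<Sum>i\<in>S. a i / card S) = sum a S / ?n"
    unfolding cS by (rule sum_divide_distrib[symmetric])
  also have "prod a S powr (1 / card S) = X"
  proof -
    have "X ^ ?n = X powr real ?n" using X by (rule powr_realpow[symmetric])
    then show ?thesis unfolding pS cS using X by (simp only: powr_powr) simp
  qed
  finally show ?thesis unfolding sS by (simp add: pos_le_divide_eq mult.commute del: power_Suc)
qed

text \<open>
  Joint convexity: after scaling each variable by its value at the intermediate point, both end values lie
  above the tangent plane there, and the plane takes the intermediate value \<open>C\<close>.
\<close>

lemma power_over_prod_convex:
  fixes x y t :: real
  assumes J: "finite J" and "0 \<le> x" "0 \<le> y" "0 \<le> t" "t \<le> 1"
    and q: "\<And>j. j \<in> J \<Longrightarrow> 0 < q j" and r: "\<And>j. j \<in> J \<Longrightarrow> 0 < r j"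
  defines "n \<equiv> Suc (card J)"
  shows "((1 - t) * x + t * y) ^ n / (\<Prod>j\<in>J. (1 - t) * q j + t * r j)
    \<le> (1 - t) * (x ^ n / prod q J) + t * (y ^ n / prod r J)"
proof -
  define z where "z = (1 - t) * x + t * y"
  define s where "s j = (1 - t) * q j + t * r j" for j
  have s: "0 < s j" if "j \<in> J" for j
    using q[OF that] r[OF that] assms(4,5) unfolding s_def
    by (cases "t = 0") (auto intro: add_nonneg_pos)
  have z: "0 \<le> z" using assms(2-5) by (simp add: z_def)
  define C where "C = z ^ n / prod s J"
  have C: "0 \<le> C" unfolding C_def using z s by (intro divide_nonneg_pos prod_pos) auto
  show ?thesis
  proof (cases "z = 0")
    case True
    have "0 \<le> x ^ n / prod q J" "0 \<le> y ^ n / prod r J"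
      using assms(2,3) q r by (auto intro!: divide_nonneg_pos prod_pos)
    then have "0 \<le> (1 - t) * (x ^ n / prod q J) + t * (y ^ n / prod r J)"
      using assms(4,5) by (intro add_nonneg_nonneg mult_nonneg_nonneg) auto
    moreover have "z ^ n = 0" using True by (simp add: n_def)
    ultimately show ?thesis by (simp only: z_def[symmetric] div_0)
  next
    case False
    then have zp: "0 < z" using z by simp
    have tangent: "C * (real n * (u / z) - (\<Sum>j\<in>J. p j / s j)) \<le> u ^ n / prod p J"
      if u: "0 \<le> u" and p: "\<And>j. j \<in> J \<Longrightarrow> 0 < p j" for u p
    proof -
      have "real n * (u / z) \<le> (u / z) ^ n / (\<Prod>j\<in>J. p j / s j) + (\<Sum>j\<in>J. p j / s j)"
        unfolding n_def using u zp p s J by (intro power_over_prod_ge_tangent) auto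
      then have "C * (real n * (u / z) - (\<Sum>j\<in>J. p j / s j)) \<le> C * ((u / z) ^ n / (\<Prod>j\<in>J. p j / s j))"
        using C by (intro mult_left_mono) auto
      also have "\<dots> = u ^ n / prod p J"
        using zp prod_pos[of J s] s by (simp add: C_def prod_dividef power_divide)
      finally show ?thesis .
    qed
    have "(\<Sum>j\<in>J. s j / s j) = (\<Sum>j\<in>J. 1)"
    proof (intro sum.cong refl)
      show "s j / s j = 1" if "j \<in> J" for j using s[OF that] by simp
    qed
    then have "C = C * (real n * (z / z) - (\<Sum>j\<in>J. s j / s j))"
      using zp by (simp add: n_def)
    also have "\<dots> = (1 - t) * (C * (real n * (x / z) - (\<Sum>j\<in>J. q j / s j)))
        + t * (C * (real n * (y / z) - (\<Sum>j\<in>J. r j / s j)))"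
    proof -
      have "(\<Sum>j\<in>J. s j / s j) = (1 - t) * (\<Sum>j\<in>J. q j / s j) + t * (\<Sum>j\<in>J. r j / s j)"
        unfolding sum_distrib_left sum.distrib[symmetric]
        by (intro sum.cong refl) (subst s_def, simp add: add_divide_distrib)
      moreover have "z / z = (1 - t) * (x / z) + t * (y / z)"
        by (subst z_def) (simp add: add_divide_distrib)
      ultimately show ?thesis by (simp only:) (simp add: algebra_simps)
    qed
    also have "\<dots> \<le> (1 - t) * (x ^ n / prod q J) + t * (y ^ n / prod r J)"
      using assms(4,5) by (intro add_mono mult_left_mono tangent assms(2,3) q r) auto
    finally show ?thesis by (simp add: C_def z_def s_def)
  qed
qed

text \<open>
  This is \<open>\<Sum>k\<le>n. l\<^sub>k\<^sup>n\<^sup>+\<^sup>1\<^sup>-\<^sup>k P\<^sub>k / P\<^sub>n\<close>, that is \<open>G\<close> for \<open>m = n + 1\<close> multiplied by \<open>P\<^sub>m / P\<^sub>m\<^sub>-\<^sub>1\<close>, with the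
  quotients written as products of concave ratios.
\<close>

definition G_numerator :: "nat \<Rightarrow> real^'d^'d \<Rightarrow> (nat \<Rightarrow> real) \<Rightarrow> real" where
  "G_numerator n w l = (\<Sum>k\<le>n. l k ^ Suc (n - k) / (\<Prod>j=k..<n. P_ratio j w))"

lemma P_sym_eq_prod_P_ratio:
  assumes "w \<in> garding_cone n" "k \<le> n"
  shows "P_sym n w = P_sym k w * (\<Prod>j=k..<n. P_ratio j w)"
  using assms(2,1)
proof (induction rule: dec_induct)
  case (step n)
  have "w \<in> garding_cone n" using step.prems garding_cone_antimono[of n "Suc n"] by auto
  moreover have "0 < P_sym n w" using step.prems by (simp add: garding_cone_def)
  ultimately have "P_sym (Suc n) w = P_sym n w * P_ratio n w" by (simp add: P_ratio_def)
  also have "P_sym n w = P_sym k w * (\<Prod>j=k..<n. P_ratio j w)"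
    by (rule step.IH) fact
  finally show ?case using step.hyps(1) by (simp only: prod.atLeastLessThan_Suc mult.assoc)
qed simp

lemma G_fun_eq:
  assumes w: "w \<in> garding_cone (Suc n)"
  shows "G_fun (Suc n) w l = G_numerator n w l / P_ratio n w"
proof -
  have wn: "w \<in> garding_cone n" using w garding_cone_antimono[of n "Suc n"] by auto
  have pos: "0 < P_sym k w" if "k \<le> Suc n" for k using w that by (simp add: garding_cone_def)
  have "l k ^ (Suc n - k) * (P_sym k w / P_sym (Suc n) w)
      = l k ^ Suc (n - k) / (\<Prod>j=k..<n. P_ratio j w) / P_ratio n w" if "k \<le> n" for k
  proof -
    have "P_sym (Suc n) w = P_sym k w * (\<Prod>j=k..<n. P_ratio j w) * P_ratio n w"
      using P_sym_eq_prod_P_ratio[OF w, of k] that by simp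
    then show ?thesis using pos[of k] that by (simp add: Suc_diff_le)
  qed
  then show ?thesis
    unfolding G_fun_def G_numerator_def sum_divide_distrib lessThan_Suc_atMost
    by (intro sum.cong) auto
qed

lemma G_numerator_nonneg:
  assumes "w \<in> garding_cone n" "\<forall>k\<le>n. 0 \<le> l k"
  shows "0 \<le> G_numerator n w l"
  unfolding G_numerator_def using assms
  by (intro sum_nonneg divide_nonneg_pos prod_pos) (auto intro: P_ratio_pos)

text \<open>
  Enlarging the denominators of the intermediate point from the interpolated ratios to the actual ones
  only decreases the summand, by concavity of the ratios; what remains is convex.
\<close>

lemma G_numerator_convex:
  assumes w: "w \<in> garding_cone n" "w' \<in> garding_cone n" and t: "0 \<le> t" "t \<le> 1"
    and l: "\<forall>k\<le>n. 0 \<le> l k" "\<forall>k\<le>n. 0 \<le> l' k"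
  shows "G_numerator n ((1 - t) *\<^sub>R w + t *\<^sub>R w') (\<lambda>k. (1 - t) * l k + t * l' k)
    \<le> (1 - t) * G_numerator n w l + t * G_numerator n w' l'"
  unfolding G_numerator_def sum_distrib_left sum.distrib[symmetric]
proof (intro sum_mono)
  fix k assume "k \<in> {..n}"
  then have k: "k \<le> n" by simp
  let ?z = "(1 - t) *\<^sub>R w + t *\<^sub>R w'"
  have sub: "garding_cone n \<subseteq> garding_cone j" if "j \<in> {k..<n}" for j
    using that by (intro garding_cone_antimono) auto
  have z: "?z \<in> garding_cone n" by (rule garding_cone_segment[OF w t])
  have mid: "0 < (1 - t) * P_ratio j w + t * P_ratio j w'" if "j \<in> {k..<n}" for j
    using that P_ratio_pos[OF w(1), of j] P_ratio_pos[OF w(2), of j] t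
    by (cases "t = 0") (auto intro: add_nonneg_pos)
  have "((1 - t) * l k + t * l' k) ^ Suc (n - k) / (\<Prod>j=k..<n. P_ratio j ?z)
      \<le> ((1 - t) * l k + t * l' k) ^ Suc (n - k) / (\<Prod>j=k..<n. (1 - t) * P_ratio j w + t * P_ratio j w')"
  proof (intro divide_left_mono prod_mono conjI mult_pos_pos prod_pos)
    show "(1 - t) * P_ratio j w + t * P_ratio j w' \<le> P_ratio j ?z" if "j \<in> {k..<n}" for j
      using sub[OF that] w z t by (intro P_ratio_concave) auto
    show "0 < P_ratio j ?z" if "j \<in> {k..<n}" for j
      using that by (intro P_ratio_pos[OF z]) auto
    show "0 \<le> ((1 - t) * l k + t * l' k) ^ Suc (n - k)"
      using l k t by (intro zero_le_power add_nonneg_nonneg mult_nonneg_nonneg) auto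
  qed (use mid in \<open>auto intro: less_imp_le\<close>)
  also have "\<dots> \<le> (1 - t) * (l k ^ Suc (n - k) / (\<Prod>j=k..<n. P_ratio j w))
      + t * (l' k ^ Suc (n - k) / (\<Prod>j=k..<n. P_ratio j w'))"
    using power_over_prod_convex[of "{k..<n}" "l k" "l' k" t "\<lambda>j. P_ratio j w" "\<lambda>j. P_ratio j w'"]
      l k t P_ratio_pos[OF w(1)] P_ratio_pos[OF w(2)] by simp
  finally show "((1 - t) * l k + t * l' k) ^ Suc (n - k) / (\<Prod>j=k..<n. P_ratio j ?z)
    \<le> (1 - t) * (l k ^ Suc (n - k) / (\<Prod>j=k..<n. P_ratio j w))
      + t * (l' k ^ Suc (n - k) / (\<Prod>j=k..<n. P_ratio j w'))" .
qed

lemma G_fun_quasiconvex: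
  assumes w: "w \<in> garding_cone (Suc n)" "w' \<in> garding_cone (Suc n)" and t: "0 \<le> t" "t \<le> 1"
    and l: "\<forall>k\<le>n. 0 \<le> l k" "\<forall>k\<le>n. 0 \<le> l' k"
  shows "G_fun (Suc n) ((1 - t) *\<^sub>R w + t *\<^sub>R w') (\<lambda>k. (1 - t) * l k + t * l' k)
    \<le> max (G_fun (Suc n) w l) (G_fun (Suc n) w' l')"
proof -
  let ?z = "(1 - t) *\<^sub>R w + t *\<^sub>R w'"
  define a where "a = max (G_fun (Suc n) w l) (G_fun (Suc n) w' l')"
  have z: "?z \<in> garding_cone (Suc n)" by (rule garding_cone_segment[OF w t])
  have sub: "garding_cone (Suc n) \<subseteq> garding_cone n" by (intro garding_cone_antimono) simp
  then have wn: "w \<in> garding_cone n" "w' \<in> garding_cone n" "?z \<in> garding_cone n" using w z by auto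
  have pos: "0 < P_ratio n w" "0 < P_ratio n w'" "0 < P_ratio n ?z"
    using w z by (auto intro: P_ratio_pos)
  have "0 \<le> G_fun (Suc n) w l"
    unfolding G_fun_eq[OF w(1)] using G_numerator_nonneg[OF wn(1) l(1)] pos(1) by simp
  then have a: "0 \<le> a" by (simp add: a_def le_max_iff_disj)
  have H: "G_numerator n w l \<le> a * P_ratio n w" "G_numerator n w' l' \<le> a * P_ratio n w'"
    unfolding a_def G_fun_eq[OF w(1)] G_fun_eq[OF w(2)]
    using pos by (simp_all add: pos_divide_le_eq[symmetric])
  have "G_numerator n ?z (\<lambda>k. (1 - t) * l k + t * l' k) \<le> (1 - t) * G_numerator n w l + t * G_numerator n w' l'"
    by (rule G_numerator_convex[OF wn(1,2) t l])
  also have "\<dots> \<le> (1 - t) * (a * P_ratio n w) + t * (a * P_ratio n w')"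
    using H t by (intro add_mono mult_left_mono) auto
  also have "\<dots> = a * ((1 - t) * P_ratio n w + t * P_ratio n w')" by (simp add: algebra_simps)
  also have "\<dots> \<le> a * P_ratio n ?z"
    using a P_ratio_concave[OF wn(1,2) t wn(3)] by (intro mult_left_mono)
  finally show ?thesis
    unfolding G_fun_eq[OF z] a_def[symmetric] using pos(3) by (simp add: pos_divide_le_eq)
qed

theorem theorem3p4:
  fixes m :: nat
    and w w' :: "real^'d^'d"
    and l l' :: "nat \<Rightarrow> real"
  assumes "2 \<le> m" and "m \<le> CARD('d)"
    and "w \<in> C_cone m" and "\<forall>k<m. 0 \<le> l k"
    and "w' \<in> C_cone m" and "\<forall>k<m. 0 \<le> l' k"
  shows "G_fun m ((1/2) *\<^sub>R (w + w')) (\<lambda>k. (l k + l' k) / 2) \<le> max (G_fun m w l) (G_fun m w' l') \<and>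
    (\<forall>t\<in>{0..1}.
      (1 - t) *\<^sub>R w + t *\<^sub>R w' \<in> C_cone m \<and>
      G_fun m ((1 - t) *\<^sub>R w + t *\<^sub>R w') (\<lambda>k. (1 - t) * l k + t * l' k)
        \<le> max (G_fun m w l) (G_fun m w' l'))"
proof -
  obtain n where n: "m = Suc n" using assms(1) by (cases m) auto
  have C: "C_cone m = (garding_cone m :: (real^'d^'d) set)"
    using assms(1,2) by (intro C_cone_eq_garding_cone) auto
  have w: "w \<in> garding_cone m" "w' \<in> garding_cone m" using assms(3,5) C by auto
  have G: "G_fun m ((1 - t) *\<^sub>R w + t *\<^sub>R w') (\<lambda>k. (1 - t) * l k + t * l' k)
      \<le> max (G_fun m w l) (G_fun m w' l')" if "0 \<le> t" "t \<le> 1" for t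
    using G_fun_quasiconvex[of w n w' t l l'] w assms(4,6) that by (simp add: n less_Suc_eq_le)
  moreover have "(1/2) *\<^sub>R (w + w') = (1 - 1/2) *\<^sub>R w + (1/2) *\<^sub>R w'"
    by (simp add: scaleR_add_right)
  moreover have "(\<lambda>k. (l k + l' k) / 2) = (\<lambda>k. (1 - 1/2) * l k + (1/2) * l' k)"
    by (simp add: add_divide_distrib)
  ultimately have "G_fun m ((1/2) *\<^sub>R (w + w')) (\<lambda>k. (l k + l' k) / 2)
      \<le> max (G_fun m w l) (G_fun m w' l')"
    using G[of "1/2"] by (simp only:)
  moreover have "(1 - t) *\<^sub>R w + t *\<^sub>R w' \<in> C_cone m" if "0 \<le> t" "t \<le> 1" for t
    unfolding C using garding_cone_segment[OF w that] .
  ultimately show ?thesis using G by auto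
qed

end
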